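(* Assume $(\dagger)$. Then: (a) there is a bounded Pettis integrable function $\phi:[0,1]\to\ell^\infty$ such that $\{g\phi:g\in(\ell^\infty)^*,\ \|g\|\le1\}$ is not stable (with respect to Lebesgue measure on $[0,1]$); (b) there is a separable convex subset of $\mathcal L^0(\Sigma_L)$ which is compact for the topology of pointwise convergence but is not stable.
   Context: $(\dagger)$ is the statement: there are sequences $\langle n_k\rangle_{k\in\mathbb N}$ of integers and $\langle W_k\rangle_{k\in\mathbb N}$ with $n_k\ge2^k$, $W_k\subseteq n_k\times n_k$ and $\#(W_k)\le2^{-k}n_k^2$ for every $k$, such that, writing $X=\prod_{k\in\mathbb N}n_k$ (integers identified with their sets of predecessors), $\mu$ for the usual product of the uniform probabilities on $X$, and $R=\{(x,y):x,y\in X,\ (x(k),y(k))\in W_k\ \forall k\in\mathbb N,\ \{k:x(k)=y(k)\}\text{ finite}\}$, whenever $D\subseteq X$ has outer measure $\mu^*D=1$ and $r\in\mathbb N$ there are $x_0,\ldots,x_r\in D$ with $(x_j,x_i)\in R$ whenever $i<j\le r$. $\Sigma_L$ is the $\sigma$-algebra of Lebesgue measurable subsets of $[0,1]$, $\mu_L$ Lebesgue measure, and $\mathcal L^0(\Sigma_L)$ the set of Lebesgue measurable real functions on $[0,1]$. $\ell^\infty$ is the Banach space of bounded real sequences. A set $A\subseteq\mathbb R^{[0,1]}$ is stable if whenever $\alpha<\beta$ are reals and $E\in\Sigma_L$ with $\mu_LE>0$ there are $k,l\ge1$ such that the product outer measure $\mu^*_{k+l}$ on $[0,1]^k\times[0,1]^l$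 of $\{(\mathbf x,\mathbf y):\mathbf x\in E^k,\ \mathbf y\in E^l,\ \exists f\in A,\ f(\mathbf x(i))\le\alpha\ \&\ f(\mathbf y(j))\ge\beta\ \forall i<k,\ j<l\}$ is less than $(\mu_LE)^{k+l}$. A function $\phi:[0,1]\to B$ ($B$ a Banach space) is scalarly measurable if $g\phi$ is measurable for every $g\in B^*$, and Pettis integrable if moreover there is $\theta:\Sigma_L\to B$ with $\int_Eg\phi\,d\mu_L$ existing and equal to $g(\theta E)$ for all $E\in\Sigma_L$, $g\in B^*$. *)

theory Defs
  imports "HOL-Probability.Probability"
begin

section \<open>The combinatorial hypothesis\<close>

definition seq_space :: "(nat \<Rightarrow> nat) \<Rightarrow> (nat \<Rightarrow> nat) set" where
  "seq_space n = (\<Pi>\<^sub>E k\<in>UNIV. {..<n k})"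

definition seq_measure :: "(nat \<Rightarrow> nat) \<Rightarrow> (nat \<Rightarrow> nat) measure" where
  "seq_measure n = (\<Pi>\<^sub>M k\<in>UNIV. uniform_count_measure {..<n k})"

definition seq_rel ::
  "(nat \<Rightarrow> nat) \<Rightarrow> (nat \<Rightarrow> (nat \<times> nat) set) \<Rightarrow> ((nat \<Rightarrow> nat) \<times> (nat \<Rightarrow> nat)) set" where
  "seq_rel n W = {(x, y). x \<in> seq_space n \<and> y \<in> seq_space n \<and>
     (\<forall>k. (x k, y k) \<in> W k) \<and> finite {k. x k = y k}}"

definition dagger :: bool where
  "dagger \<longleftrightarrow> (\<exists>(n :: nat \<Rightarrow> nat) (W :: nat \<Rightarrow> (nat \<times> nat) set).
     (\<forall>k. 2 ^ k \<le> n k \<and> W k \<subseteq> {..<n k} \<times> {..<n k} \<and>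
          real (card (W k)) \<le> (1 / 2) ^ k * (real (n k))\<^sup>2) \<and>
     (\<forall>D (r :: nat). D \<subseteq> seq_space n \<and> outer_measure_of (seq_measure n) D = 1 \<longrightarrow>
        (\<exists>x :: nat \<Rightarrow> (nat \<Rightarrow> nat).
           (\<forall>i\<le>r. x i \<in> D) \<and> (\<forall>i j. i < j \<and> j \<le> r \<longrightarrow> (x j, x i) \<in> seq_rel n W))))"


section \<open>Functions on the unit interval\<close>

text \<open>
  Elements of \<open>\<real>\<^bsup>[0,1]\<^esup>\<close> are represented by functions that are extensional on \<open>{0..1}\<close>, in
  agreement with the carrier of the product topology over the index set \<open>{0..1}\<close>.
\<close>

abbreviation lebesgue_01 :: "real measure" where
  "lebesgue_01 \<equiv> lebesgue_on {0..1}"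

definition L0_01 :: "(real \<Rightarrow> real) set" where
  "L0_01 = {f \<in> extensional {0..1}. f \<in> borel_measurable lebesgue_01}"

text \<open>
  Function types carry no vector space structure here, so convexity is spelled out pointwise.
\<close>

definition convex_01 :: "(real \<Rightarrow> real) set \<Rightarrow> bool" where
  "convex_01 K \<longleftrightarrow> (\<forall>f\<in>K. \<forall>g\<in>K. \<forall>u\<in>{0..1}.
     (\<lambda>t\<in>{0..1}. (1 - u) * f t + u * g t) \<in> K)"

text \<open>
  The measure below need not be complete, but its outer measure is that of its completion.
\<close>

definition stable_01 :: "(real \<Rightarrow> real) set \<Rightarrow> bool" where
  "stable_01 A \<longleftrightarrow> (\<forall>(\<alpha> :: real) (\<beta> :: real) E.
     \<alpha> < \<beta> \<and> E \<in> sets lebesgue_01 \<and> emeasure lebesgue_01 E > 0 \<longrightarrow>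
     (\<exists>(k :: nat) (l :: nat). k \<ge> 1 \<and> l \<ge> 1 \<and>
        outer_measure_of
          ((\<Pi>\<^sub>M i\<in>{..<k}. lebesgue_01) \<Otimes>\<^sub>M (\<Pi>\<^sub>M j\<in>{..<l}. lebesgue_01))
          {(x, y). x \<in> (\<Pi>\<^sub>E i\<in>{..<k}. E) \<and> y \<in> (\<Pi>\<^sub>E j\<in>{..<l}. E) \<and>
             (\<exists>f\<in>A. \<forall>i<k. \<forall>j<l. f (x i) \<le> \<alpha> \<and> f (y j) \<ge> \<beta>)}
        < emeasure lebesgue_01 E ^ (k + l)))"


section \<open>Pettis integrability\<close>

definition scalarly_measurable_01 :: "(real \<Rightarrow> 'b :: banach) \<Rightarrow> bool" where
  "scalarly_measurable_01 \<phi> \<longleftrightarrow>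
     (\<forall>g :: 'b \<Rightarrow>\<^sub>L real. (\<lambda>t. g (\<phi> t)) \<in> borel_measurable lebesgue_01)"

definition Pettis_integrable_01 :: "(real \<Rightarrow> 'b :: banach) \<Rightarrow> bool" where
  "Pettis_integrable_01 \<phi> \<longleftrightarrow> scalarly_measurable_01 \<phi> \<and>
     (\<exists>\<theta> :: real set \<Rightarrow> 'b. \<forall>E\<in>sets lebesgue_01. \<forall>g :: 'b \<Rightarrow>\<^sub>L real.
        set_integrable lebesgue_01 E (\<lambda>t. g (\<phi> t)) \<and>
        set_lebesgue_integral lebesgue_01 E (\<lambda>t. g (\<phi> t)) = g (\<theta> E))"

text \<open>
  Every function on the discrete space \<^typ>\<open>nat\<close> is continuous, so the bounded continuous
  functions on it, with their supremum norm, are exactly the bounded real sequences.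
\<close>

text \<open>
  The library proves completeness only over metric domains, and \<^typ>\<open>nat\<close> has no metric there.
\<close>

instance bcontfun :: (topological_space, complete_space) complete_space
proof
  fix f :: "nat \<Rightarrow> ('a, 'b) bcontfun"
  assume C: "Cauchy f"
  have "\<exists>M. \<forall>m\<ge>M. \<forall>n\<ge>M. \<forall>x. dist (f m x) (f n x) < e" if "e > 0" for e
    using C that unfolding Cauchy_def by (metis dist_fun_lt_imp_dist_val_lt)
  then have "uniformly_Cauchy_on UNIV (\<lambda>n. apply_bcontfun (f n))"
    unfolding uniformly_Cauchy_on_def by blast
  then obtain g where "uniform_limit UNIV (\<lambda>n. apply_bcontfun (f n)) g sequentially"
    using Cauchy_uniformly_convergent uniformly_convergent_on_def by blast
  then show "convergent f"
    by (metis uniform_limit_bcontfunE sequentially_bot convergentI)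
qed

instance bcontfun :: (topological_space, banach) banach ..

type_synonym linfty = "nat \<Rightarrow>\<^sub>C real"

end

theory Submission
  imports Defs "HOL-Real_Asymp.Real_Asymp"
begin

text \<open>
  Transport \<open>\<mu>\<close> to \<open>[0,1]\<close> by reading off mixed radix digits. For a stage \<open>m\<close> and a set \<open>S\<close> of at
  most \<open>m\<close> values, no two distinct ones related by \<open>W m\<close>, test whether the \<open>m\<close>-th digit lies in
  \<open>S\<close>. Random points are eventually unrelated, so the countably many tests separate almost every
  pair of disjoint finite samples and are not stable. On the other hand, two points eventually related
  and distinct pass only finitely many tests in common. So if a functional on \<open>\<ell>\<^sup>\<infinity>\<close> vanishing
  on finitely supported sequences were at least \<open>\<epsilon>\<close> at the test sequences of a non-null set of points,
  then a long chain in that set would give a sum of norm at most 1 modulo finitely supported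
  sequences on which the functional is arbitrarily large. Hence every functional of
  the test sequence agrees almost everywhere with an absolutely convergent series of tests; and the
  integrals of the tests tend to 0 since \<open>m / 2\<^sup>m\<close> does, which makes the Pettis integral lie in
  \<open>c\<^sub>0\<close>. The closed convex hull of the tests consists of such functions.
\<close>

subsection \<open>Mixed radix digits\<close>

text \<open>The product includes \<open>n k\<close>, so this is the \<open>k\<close>-th digit of
  \<open>t\<close> with bases \<open>n 0, n 1, ...\<close>, most significant first. At
  \<open>t = 1\<close> all digits are 0 when the bases are positive.\<close>

definition radix_digit :: "(nat \<Rightarrow> nat) \<Rightarrow> nat \<Rightarrow> real \<Rightarrow> nat" where
  "radix_digit n k t = nat \<lfloor>real (\<Prod>i\<le>k. n i) * t\<rfloor> mod n k"

text \<open>Horner evaluation with \<open>a 0\<close> most significant: the integer whose block of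
  \<open>k\<close> mixed radix digits is \<open>a\<close>.\<close>

primrec radix_value :: "(nat \<Rightarrow> nat) \<Rightarrow> (nat \<Rightarrow> nat) \<Rightarrow> nat \<Rightarrow> nat" where
  "radix_value n a 0 = 0"
| "radix_value n a (Suc k) = radix_value n a k * n k + a k"

lemma radix_value_less:
  assumes "\<And>j. j < k \<Longrightarrow> a j < n j"
  shows "radix_value n a k < (\<Prod>i<k. n i)"
  using assms
proof (induction k)
  case (Suc k)
  have "radix_value n a k * n k + a k < (radix_value n a k + 1) * n k"
    using Suc.prems[of k] by simp
  also have "\<dots> \<le> (\<Prod>i<k. n i) * n k"
    using Suc by (intro mult_right_mono) auto
  finally show ?case by simp
qed simp

text \<open>Dividing the integer part at level \<open>k + 1\<close> by \<open>n k\<close> leaves the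
  digit \<open>k\<close> as remainder and the integer part at level \<open>k\<close> as quotient. So
  a block of digits and one integer determine each other.\<close>

lemma radix_digits_eq_iff:
  assumes t: "0 \<le> t" "t < 1" and n: "\<And>k. 0 < n k" and a: "\<And>j. j < k \<Longrightarrow> a j < n j"
  shows "(\<forall>j<k. radix_digit n j t = a j) \<longleftrightarrow> nat \<lfloor>real (\<Prod>i<k. n i) * t\<rfloor> = radix_value n a k"
  using a
proof (induction k)
  case 0
  show ?case using t by (simp add: floor_eq_iff)
next
  case (Suc k)
  define q where "q = nat \<lfloor>real (\<Prod>i<Suc k. n i) * t\<rfloor>"
  have "real (\<Prod>i<k. n i) * t = (real (\<Prod>i<Suc k. n i) * t) / real_of_int (int (n k))"
    using n[of k] by simp
  then have "\<lfloor>real (\<Prod>i<k. n i) * t\<rfloor> = \<lfloor>real (\<Prod>i<Suc k. n i) * t\<rfloor> div int (n k)"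
    using floor_divide_real_eq_div[of "int (n k)" "real (\<Prod>i<Suc k. n i) * t"]
    by (metis of_nat_0_le_iff)
  then have qd: "nat \<lfloor>real (\<Prod>i<k. n i) * t\<rfloor> = q div n k"
    by (simp add: q_def nat_div_distrib')
  have qm: "radix_digit n k t = q mod n k"
    by (simp add: radix_digit_def q_def lessThan_Suc_atMost)
  have "(\<forall>j<Suc k. radix_digit n j t = a j) \<longleftrightarrow>
      q div n k = radix_value n a k \<and> q mod n k = a k"
    using Suc qd qm by (auto simp: less_Suc_eq)
  also have "\<dots> \<longleftrightarrow> q = radix_value n a (Suc k)"
    using Suc.prems[of k] by (auto simp: mult.commute) (metis mult_div_mod_eq mult.commute)
  finally show ?case by (simp add: q_def)
qed

lemma measurable_radix_digit [measurable]:
  "radix_digit n k \<in> lebesgue_01 \<rightarrow>\<^sub>M count_space UNIV"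
proof -
  have "radix_digit n k \<in> borel \<rightarrow>\<^sub>M count_space UNIV"
    unfolding radix_digit_def by measurable
  then show ?thesis
    by (intro measurable_restrict_space1 measurable_completion) simp
qed

lemma prob_space_lebesgue_01: "prob_space lebesgue_01"
  by (rule prob_spaceI) (simp add: emeasure_restrict_space)

text \<open>Prescribing the first \<open>k\<close> digits confines \<open>t\<close> to one half-open
  interval whose length is the reciprocal of the product of the bases, apart from the endpoint
  1.\<close>

lemma emeasure_radix_digits:
  assumes n: "\<And>k. 0 < n k" and a: "\<And>j. j < k \<Longrightarrow> a j < n j"
  shows "emeasure lebesgue_01 {t\<in>{0..1}. \<forall>j<k. radix_digit n j t = a j} = ennreal (1 / (\<Prod>i<k. n i))"
proof -
  define N where "N = (\<Prod>i<k. n i)"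
  define c where "c = radix_value n a k"
  have N: "0 < N" using n by (simp add: N_def prod_pos)
  have c: "c < N" using radix_value_less[OF a] by (simp add: N_def c_def)
  have eq: "nat \<lfloor>real N * t\<rfloor> = c \<longleftrightarrow> t \<in> {c / N..<(c + 1) / N}" if "0 \<le> t" for t
  proof -
    have "nat \<lfloor>real N * t\<rfloor> = c \<longleftrightarrow> \<lfloor>real N * t\<rfloor> = int c"
      using that by (subst nat_eq_iff) simp
    then show ?thesis
      using N by (auto simp: floor_eq_iff field_simps)
  qed
  have ivl: "{c / N..<(c + 1) / N} \<subseteq> {0..<1}"
  proof -
    have "real (c + 1) / N \<le> 1" using c N by (simp add: divide_simps)
    then show ?thesis
      by (intro subsetI, unfold atLeastLessThan_iff)
        (meson divide_nonneg_nonneg of_nat_0_le_iff order_trans less_le_trans)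
  qed
  have meas [measurable]: "{t\<in>{0..1}. \<forall>j<k. radix_digit n j t = a j} \<in> sets lebesgue_01"
  proof -
    have "{t\<in>space lebesgue_01. \<forall>j<k. radix_digit n j t = a j} \<in> sets lebesgue_01" by measurable
    then show ?thesis by simp
  qed
  have ivl01: "{c / N..<(c + 1) / N} \<subseteq> {0..1}" by (rule order_trans[OF ivl]) auto
  then have ivl_meas: "{c / N..<(c + 1) / N} \<in> sets lebesgue_01"
    by (simp add: sets_restrict_space_iff)
  \<comment> \<open>The point 1 has only zero digits but lies in no half-open cell inside
    \<open>{0..<1}\<close>, so the two sets need agree only almost everywhere.\<close>
  have null: "{1::real} \<in> null_sets lebesgue_01"
    by (simp add: null_sets_restrict_space negligible_iff_null_sets[symmetric])
  have "emeasure lebesgue_01 {t\<in>{0..1}. \<forall>j<k. radix_digit n j t = a j}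
      = emeasure lebesgue_01 {c / N..<(c + 1) / N}"
  proof (rule emeasure_eq_AE[OF _ meas ivl_meas], rule AE_I'[OF null], clarsimp)
    fix t :: real
    assume t: "0 \<le> t" "t \<le> 1"
      "(\<forall>j<k. radix_digit n j t = a j) \<longleftrightarrow> real c / real N \<le> t \<longrightarrow> \<not> t < (1 + real c) / real N"
    show "t = 1"
    proof (rule ccontr)
      assume "t \<noteq> 1"
      then have "(\<forall>j<k. radix_digit n j t = a j) \<longleftrightarrow> t \<in> {c / N..<(c + 1) / N}"
        using radix_digits_eq_iff[of t n k a] eq t(1,2) n a by (simp add: N_def c_def)
      then show False using t(3) by auto
    qed
  qed
  also have "\<dots> = emeasure lborel {c / N..<(c + 1) / N}"
    using ivl01 by (subst emeasure_restrict_space) auto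
  also have "\<dots> = ennreal (1 / N)"
    using N by (subst emeasure_lborel_Ico) (auto simp: field_simps)
  finally show ?thesis by (simp add: N_def)
qed

section \<open>The digit map carries Lebesgue measure to the product measure\<close>

definition radix_digits :: "(nat \<Rightarrow> nat) \<Rightarrow> real \<Rightarrow> nat \<Rightarrow> nat" where
  "radix_digits n t = (\<lambda>k. radix_digit n k t)"

lemma radix_digit_less: "0 < n k \<Longrightarrow> radix_digit n k t < n k"
  by (simp add: radix_digit_def)

lemma space_seq_measure: "space (seq_measure n) = seq_space n"
  by (simp add: seq_measure_def seq_space_def space_PiM space_uniform_count_measure)

text \<open>The event is a disjoint union over the digit strings in \<open>PiE {..<k} B\<close>, all
  of equal measure, so its measure is found by counting.\<close>

lemma emeasure_radix_digits_cylinder: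
  assumes n: "\<And>k. 0 < n k" and B: "\<And>j. j < k \<Longrightarrow> B j \<subseteq> {..<n j}"
  shows "emeasure lebesgue_01 {t\<in>{0..1}. \<forall>j<k. radix_digit n j t \<in> B j} =
         (\<Prod>j<k. ennreal (card (B j) / n j))"
proof -
  let ?C = "\<lambda>a. {t\<in>{0..1}. \<forall>j<k. radix_digit n j t = a j}"
  have fin: "finite (PiE {..<k} B)"
    using B by (intro finite_PiE) (auto intro: finite_subset)
  have meas: "?C a \<in> sets lebesgue_01" for a
  proof -
    have "{t\<in>space lebesgue_01. \<forall>j<k. radix_digit n j t = a j} \<in> sets lebesgue_01" by measurable
    then show ?thesis by simp
  qed
  have "{t\<in>{0..1}. \<forall>j<k. radix_digit n j t \<in> B j} = (\<Union>a\<in>PiE {..<k} B. ?C a)"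
  proof safe
    fix t :: real
    assume t: "t \<in> {0..1}" "\<forall>j<k. radix_digit n j t \<in> B j"
    then show "t \<in> (\<Union>a\<in>PiE {..<k} B. ?C a)"
      by (intro UN_I[where a = "\<lambda>j\<in>{..<k}. radix_digit n j t"]) auto
  qed (auto simp: PiE_iff)
  then have "emeasure lebesgue_01 {t\<in>{0..1}. \<forall>j<k. radix_digit n j t \<in> B j}
      = emeasure lebesgue_01 (\<Union>a\<in>PiE {..<k} B. ?C a)" by simp
  also have "\<dots> = (\<Sum>a\<in>PiE {..<k} B. emeasure lebesgue_01 (?C a))"
  proof (rule sum_emeasure[symmetric, OF _ _ fin])
    show "disjoint_family_on ?C (PiE {..<k} B)"
    proof (clarsimp simp: disjoint_family_on_def, safe)
      fix a b t assume ab: "a \<in> PiE {..<k} B" "b \<in> PiE {..<k} B" "a \<noteq> b"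
        and t: "\<forall>j<k. radix_digit n j t = a j" "\<forall>j<k. radix_digit n j t = b j"
      have "a = b" by (rule PiE_ext[OF ab(1,2)]) (use t in auto)
      then show "t \<in> {}" using ab by simp
    qed
  qed (use meas in auto)
  also have "\<dots> = (\<Sum>a\<in>PiE {..<k} B. ennreal (1 / (\<Prod>i<k. n i)))"
  proof (intro sum.cong refl)
    fix a assume "a \<in> PiE {..<k} B"
    then show "emeasure lebesgue_01 (?C a) = ennreal (1 / (\<Prod>i<k. n i))"
      using B emeasure_radix_digits[of n k a] n by (auto simp: PiE_iff subset_eq)
  qed
  also have "\<dots> = ennreal (card (PiE {..<k} B) / (\<Prod>i<k. n i))"
    by (simp add: ennreal_of_nat_eq_real_of_nat flip: ennreal_mult')
  also have "card (PiE {..<k} B) = (\<Prod>j<k. card (B j))"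
    by (simp add: card_PiE)
  also have "ennreal (real (\<Prod>j<k. card (B j)) / real (\<Prod>i<k. n i)) = (\<Prod>j<k. ennreal (card (B j) / n j))"
    by (subst prod_ennreal) (auto simp: prod_dividef)
  finally show ?thesis by simp
qed

lemma measurable_radix_digits [measurable]:
  assumes n: "\<And>k. 0 < n k"
  shows "radix_digits n \<in> lebesgue_01 \<rightarrow>\<^sub>M seq_measure n"
  unfolding seq_measure_def
proof (rule measurable_PiM_single')
  show "(\<lambda>t. radix_digits n t k) \<in> lebesgue_01 \<rightarrow>\<^sub>M uniform_count_measure {..<n k}" for k
  proof -
    have "radix_digit n k \<in> lebesgue_01 \<rightarrow>\<^sub>M count_space {..<n k}"
      by (rule measurable_count_space_extend[of _ UNIV]) (use radix_digit_less[of n, OF n] in auto)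
    then show ?thesis
      by (simp add: radix_digits_def cong: measurable_cong_sets)
  qed
qed (auto simp: radix_digits_def space_uniform_count_measure radix_digit_less[of n, OF n])

lemma distr_radix_digits:
  assumes n: "\<And>k. 0 < n k"
  shows "distr lebesgue_01 (seq_measure n) (radix_digits n) = seq_measure n"
proof (subst (2) seq_measure_def, rule measure_eqI_PiM_infinite)
  let ?M = "\<lambda>k. uniform_count_measure {..<n k}"
  interpret L: prob_space lebesgue_01 by (rule prob_space_lebesgue_01)
  note T = measurable_radix_digits[OF n, measurable]
  show "finite_measure (distr lebesgue_01 (seq_measure n) (radix_digits n))"
    by (intro prob_space.finite_measure L.prob_space_distr T)
  fix A J
  assume J: "finite (J :: nat set)" and A: "\<And>i. i \<in> J \<Longrightarrow> A i \<in> sets (?M i)"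
  have P: "prob_space (?M i)" for i
    using n by (intro prob_space_uniform_count_measure) (auto simp: lessThan_empty_iff)
  obtain k where k: "J \<subseteq> {..<k}" using finite_nat_iff_bounded J by blast
  \<comment> \<open>Coordinates outside \<open>J\<close> are left free and contribute the factor 1;
    the event then concerns an initial block of digits.\<close>
  define B where "B j = (if j \<in> J then A j else {..<n j})" for j
  have B: "B j \<subseteq> {..<n j}" for j
    using A by (auto simp: B_def sets_uniform_count_measure)
  have E: "prod_emb UNIV ?M J (Pi\<^sub>E J A) \<in> sets (seq_measure n)"
    unfolding seq_measure_def using J A by (intro sets_PiM_I) auto
  have "emeasure (distr lebesgue_01 (seq_measure n) (radix_digits n)) (prod_emb UNIV ?M J (Pi\<^sub>E J A))
      = emeasure lebesgue_01 (radix_digits n -` prod_emb UNIV ?M J (Pi\<^sub>E J A) \<inter> {0..1})"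
    using E by (subst emeasure_distr) (auto simp: T)
  also have "radix_digits n -` prod_emb UNIV ?M J (Pi\<^sub>E J A) \<inter> {0..1}
      = {t\<in>{0..1}. \<forall>j<k. radix_digit n j t \<in> B j}"
    using radix_digit_less[of n, OF n] subsetD[OF k]
    by (auto simp: prod_emb_def B_def radix_digits_def space_uniform_count_measure PiE_iff)
  also have "emeasure lebesgue_01 \<dots> = (\<Prod>j<k. ennreal (card (B j) / n j))"
    by (rule emeasure_radix_digits_cylinder[OF n B])
  also have "\<dots> = (\<Prod>j\<in>J. ennreal (card (B j) / n j))"
    using k n by (intro prod.mono_neutral_right) (auto simp: B_def)
  also have "\<dots> = (\<Prod>j\<in>J. emeasure (?M j) (A j))"
    using A by (intro prod.cong refl)
      (auto simp: B_def emeasure_uniform_count_measure sets_uniform_count_measure)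
  also have "\<dots> = emeasure (PiM UNIV ?M) (prod_emb UNIV ?M J (Pi\<^sub>E J A))"
    using J A P by (intro emeasure_PiM_emb[symmetric]) auto
  finally show "emeasure (distr lebesgue_01 (seq_measure n) (radix_digits n)) (prod_emb UNIV ?M J (Pi\<^sub>E J A))
    = emeasure (PiM UNIV ?M) (prod_emb UNIV ?M J (Pi\<^sub>E J A))" .
qed (auto simp: seq_measure_def)

section \<open>Outer measure in the product space and the zero-one law\<close>

lemma prob_space_seq_measure: "(\<And>k. 0 < n k) \<Longrightarrow> prob_space (seq_measure n)"
  unfolding seq_measure_def
  by (intro prob_space_PiM prob_space_uniform_count_measure) (auto simp: lessThan_empty_iff)

text \<open>A measurable hull of the image pulls back to a measurable superset of \<open>D\<close>
  of the same measure. In this way a non-null subset of the interval yields a non-null set of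
  sequences.\<close>

lemma outer_measure_of_radix_digits_image:
  assumes n: "\<And>k. 0 < n k" and D: "D \<subseteq> {0..1}"
  shows "outer_measure_of lebesgue_01 D \<le> outer_measure_of (seq_measure n) (radix_digits n ` D)"
proof -
  note T = measurable_radix_digits[OF n]
  have "radix_digits n ` D \<subseteq> space (seq_measure n)"
  proof (rule image_subsetI)
    fix t assume "t \<in> D"
    with D have "t \<in> space lebesgue_01" by auto
    then show "radix_digits n t \<in> space (seq_measure n)" by (rule measurable_space[OF T])
  qed
  then obtain H where H: "H \<in> sets (seq_measure n)" "radix_digits n ` D \<subseteq> H"
    "outer_measure_of (seq_measure n) (radix_digits n ` D) = emeasure (seq_measure n) H"
    by (meson outer_measure_of_attain)
  have "outer_measure_of lebesgue_01 D \<le> outer_measure_of lebesgue_01 (radix_digits n -` H \<inter> {0..1})"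
    using H D by (intro outer_measure_of_mono) auto
  also have "\<dots> = emeasure lebesgue_01 (radix_digits n -` H \<inter> space lebesgue_01)"
    using measurable_sets[OF T H(1)] by simp
  also have "\<dots> = emeasure (seq_measure n) H"
    using emeasure_distr[OF T H(1)] by (simp add: distr_radix_digits n)
  finally show ?thesis using H(3) by simp
qed

text \<open>
  If \<open>H\<close> is a measurable hull of \<open>D\<close>, the points all of whose finite modifications lie in \<open>H\<close> form
  a tail event between \<open>D\<close> and \<open>H\<close>, so Kolmogorov's zero-one law applies.
\<close>

lemma outer_measure_of_finite_modification_closed:
  assumes n: "\<And>k. 0 < n k" and D: "D \<subseteq> seq_space n"
    and pos: "outer_measure_of (seq_measure n) D > 0"
    and closed: "\<And>x y. x \<in> D \<Longrightarrow> y \<in> seq_space n \<Longrightarrow> finite {k. x k \<noteq> y k} \<Longrightarrow> y \<in> D"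
  shows "outer_measure_of (seq_measure n) D = 1"
proof -
  let ?P = "seq_measure n" let ?M = "\<lambda>k. uniform_count_measure {..<n k}"
  interpret P: prob_space ?P by (rule prob_space_seq_measure) (rule n)
  obtain H where H: "H \<in> sets ?P" "D \<subseteq> H" "outer_measure_of ?P D = emeasure ?P H"
    using outer_measure_of_attain[of D ?P] D by (auto simp: space_seq_measure)
  define merge where "merge k a x = (\<lambda>j. if j < k then a j else x j)" for k :: nat and a x :: "nat \<Rightarrow> nat"
  define L where "L k = PiE {..<k} (\<lambda>j. {..<n j})" for k :: nat
  \<comment> \<open>Points that stay in \<open>H\<close> under all replacements of the first
    \<open>k\<close> coordinates, for every \<open>k\<close> from \<open>K\<close> on. Only
    coordinates from \<open>K\<close> on enter, and the set is the same for every \<open>K\<close>;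
    hence it is a tail event.\<close>
  define H' where "H' K = {x\<in>seq_space n. \<forall>k\<ge>K. \<forall>a\<in>L k. merge k a x \<in> H}" for K
  have finL: "finite (L k)" for k by (auto simp: L_def intro: finite_PiE)
  have H'_eq: "H' K = H' 0" for K
  proof safe
    fix x assume "x \<in> H' K"
    then have x: "x \<in> seq_space n" "\<And>k a. k \<ge> K \<Longrightarrow> a \<in> L k \<Longrightarrow> merge k a x \<in> H"
      by (auto simp: H'_def)
    show "x \<in> H' 0"
      unfolding H'_def
    proof (safe intro!: x(1))
      fix k a assume a: "a \<in> L k"
      \<comment> \<open>A change of the first \<open>k\<close> coordinates is also a change of the
        first \<open>max k K\<close>, in which the extra entries are those of \<open>x\<close>
        itself.\<close>
      define b where "b = restrict (merge k a x) {..<max k K}"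
      have "b \<in> L (max k K)"
        using a x(1) by (auto simp: b_def L_def merge_def seq_space_def PiE_iff)
      then have "merge (max k K) b x \<in> H" using x(2) by simp
      also have "merge (max k K) b x = merge k a x"
        by (auto simp: b_def merge_def fun_eq_iff)
      finally show "merge k a x \<in> H" .
    qed
  qed (auto simp: H'_def)
  define A where "A i = {(\<lambda>x. x i) -` B \<inter> space ?P | B. B \<in> sets (?M i)}" for i
  have A_sub: "\<Union>(A ` {K..}) \<subseteq> Pow (space ?P)" for K by (auto simp: A_def)
  \<comment> \<open>After merging, the coordinates below \<open>k\<close> are constants and the
    others have index at least \<open>K\<close>, so the merge is measurable for the sigma-algebra
    generated by the coordinates from \<open>K\<close> on.\<close>
  have merge_meas: "{x\<in>seq_space n. merge k a x \<in> H} \<in> sigma_sets (space ?P) (\<Union>(A ` {K..}))"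
    if "k \<ge> K" "a \<in> L k" for k K a
  proof -
    let ?S = "sigma (space ?P) (\<Union>(A ` {K..}))"
    have space_S: "space ?S = space ?P" by (rule space_measure_of[OF A_sub])
    have sets_S: "sets ?S = sigma_sets (space ?P) (\<Union>(A ` {K..}))" by (rule sets_measure_of[OF A_sub])
    have a: "a i < n i" if "i < k" for i
      using \<open>a \<in> L k\<close> that by (simp add: L_def PiE_iff)
    have "merge k a \<in> ?S \<rightarrow>\<^sub>M PiM UNIV ?M"
    proof (rule measurable_PiM_single')
      fix i
      show "(\<lambda>x. merge k a x i) \<in> ?S \<rightarrow>\<^sub>M ?M i"
      proof (cases "i < k")
        case True
        then show ?thesis using a
          by (simp add: merge_def space_uniform_count_measure)
      next
        case False
        have "(\<lambda>x. x i) \<in> ?S \<rightarrow>\<^sub>M ?M i"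
        proof (rule measurableI)
          fix x assume "x \<in> space ?S" then show "x i \<in> space (?M i)"
            unfolding space_S by (auto simp: space_seq_measure seq_space_def space_uniform_count_measure)
        next
          fix B assume "B \<in> sets (?M i)"
          then have "(\<lambda>x. x i) -` B \<inter> space ?P \<in> \<Union>(A ` {K..})"
            using that False unfolding A_def by (intro UN_I[of i]) auto
          then show "(\<lambda>x. x i) -` B \<inter> space ?S \<in> sets ?S"
            unfolding space_S sets_S by (rule sigma_sets.Basic)
        qed
        then show ?thesis using False by (simp add: merge_def)
      qed
    next
      show "merge k a \<in> space ?S \<rightarrow> (\<Pi>\<^sub>E i\<in>UNIV. space (?M i))"
        unfolding space_S
        by (auto simp: merge_def a space_uniform_count_measure space_seq_measure seq_space_def PiE_iff)
    qed
    then have "merge k a \<in> ?S \<rightarrow>\<^sub>M ?P" by (simp only: seq_measure_def)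
    from measurable_sets[OF this H(1)]
    have "merge k a -` H \<inter> space ?P \<in> sigma_sets (space ?P) (\<Union>(A ` {K..}))"
      unfolding space_S sets_S .
    also have "merge k a -` H \<inter> space ?P = {x\<in>seq_space n. merge k a x \<in> H}"
      unfolding space_seq_measure by blast
    finally show ?thesis .
  qed
  have L_nonempty: "(\<lambda>j\<in>{..<k}. 0) \<in> L k" for k
    using n by (simp add: L_def)
  have tail: "H' 0 \<in> sigma_sets (space ?P) (\<Union>(A ` {K..}))" for K
  proof -
    let ?S = "sigma (space ?P) (\<Union>(A ` {K..}))"
    have sets_S: "sets ?S = sigma_sets (space ?P) (\<Union>(A ` {K..}))" by (rule sets_measure_of[OF A_sub])
    have "(\<Inter>k\<in>{K..}. (\<Inter>a\<in>L k. {x\<in>seq_space n. merge k a x \<in> H})) \<in> sets ?S"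
    proof (rule sets.countable_INT', goal_cases)
      case 3
      have "(\<Inter>a\<in>L k. {x\<in>seq_space n. merge k a x \<in> H}) \<in> sets ?S" if k: "k \<in> {K..}" for k
      proof (rule sets.finite_INT[OF finL])
        show "L k \<noteq> {}" using L_nonempty by blast
        show "{x\<in>seq_space n. merge k a x \<in> H} \<in> sets ?S" if "a \<in> L k" for a
          unfolding sets_S using merge_meas that k by simp
      qed
      then show ?case by blast
    qed simp_all
    also have "(\<Inter>k\<in>{K..}. (\<Inter>a\<in>L k. {x\<in>seq_space n. merge k a x \<in> H})) = H' K"
      (is "?I = _")
    proof (rule set_eqI)
      fix x
      have "x \<in> ?I \<longleftrightarrow> (\<forall>k\<ge>K. \<forall>a\<in>L k. x \<in> seq_space n \<and> merge k a x \<in> H)"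
        by auto
      also have "\<dots> \<longleftrightarrow> x \<in> seq_space n \<and> (\<forall>k\<ge>K. \<forall>a\<in>L k. merge k a x \<in> H)"
        using L_nonempty[of K] by blast
      finally show "x \<in> ?I \<longleftrightarrow> x \<in> H' K"
        by (simp only: H'_def mem_Collect_eq)
    qed
    finally show ?thesis by (simp only: sets_S H'_eq[of K])
  qed
  have sig: "sigma_algebra (space ?P) (A i)" for i
  proof -
    have "A i = sets (vimage_algebra (space ?P) (\<lambda>x. x i) (?M i))"
      by (subst sets_vimage_algebra2)
        (auto simp: A_def space_seq_measure seq_space_def space_uniform_count_measure PiE_iff)
    then show ?thesis by (metis sets.sigma_algebra_axioms space_vimage_algebra)
  qed
  have "P.indep_vars ?M (\<lambda>i x. x i) UNIV"
  proof (subst P.indep_vars_iff_distr_eq_PiM)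
    have PM: "prob_space (?M i)" for i
      using n by (intro prob_space_uniform_count_measure) (auto simp: lessThan_empty_iff)
    show rv: "P.random_variable (?M i) (\<lambda>x. x i)" for i
      by (simp add: seq_measure_def)
    have "distr ?P (?M i) (\<lambda>x. x i) = ?M i" for i
      unfolding seq_measure_def by (rule distr_PiM_component) (auto intro: PM)
    then show "distr ?P (PiM UNIV ?M) (\<lambda>x. \<lambda>i\<in>UNIV. x i) = PiM UNIV (\<lambda>i. distr ?P (?M i) (\<lambda>x. x i))"
      by (simp add: seq_measure_def restrict_UNIV distr_id)
  qed auto
  then have "P.indep_sets A UNIV"
    by (simp add: P.indep_vars_def2 A_def[abs_def])
  then have prob01: "P.prob (H' 0) = 0 \<or> P.prob (H' 0) = 1"
    by (rule P.kolmogorov_0_1_law[OF sig]) (use tail in \<open>auto simp: P.tail_events_def\<close>)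
  have H'_sets: "H' 0 \<in> sets ?P"
  proof -
    have "\<Union>(A ` {0..}) \<subseteq> sets ?P"
      by (auto simp: A_def seq_measure_def intro!: measurable_sets[OF measurable_component_singleton])
    from sets.sigma_sets_subset[OF this] tail[of 0] show ?thesis by auto
  qed
  have "D \<subseteq> H' 0"
  proof
    fix x assume x: "x \<in> D"
    have "merge k a x \<in> D" if "a \<in> L k" for k a
    proof (rule closed[OF x])
      show "merge k a x \<in> seq_space n"
        using x D that by (auto simp: merge_def L_def seq_space_def PiE_iff)
      show "finite {j. x j \<noteq> merge k a x j}"
        by (rule finite_subset[of _ "{..<k}"]) (auto simp: merge_def split: if_splits)
    qed
    then show "x \<in> H' 0" using x D H(2) by (auto simp: H'_def)
  qed
  then have le: "outer_measure_of ?P D \<le> emeasure ?P (H' 0)"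
    using outer_measure_of_mono[of D "H' 0" ?P] H'_sets by simp
  have le': "emeasure ?P (H' 0) \<le> emeasure ?P H"
  proof (rule emeasure_mono[OF _ H(1)])
    show "H' 0 \<subseteq> H"
    proof
      \<comment> \<open>Replacing no coordinate at all, the case \<open>k = 0\<close>, returns
        \<open>x\<close>.\<close>
      fix x assume "x \<in> H' 0"
      then have "merge 0 (\<lambda>j\<in>{..<0}. 0) x \<in> H"
        using L_nonempty[of 0] unfolding H'_def mem_Collect_eq by blast
      then show "x \<in> H" by (simp add: merge_def)
    qed
  qed
  have "P.prob (H' 0) \<noteq> 0"
    using le pos by (auto simp: P.emeasure_eq_measure)
  then have "emeasure ?P (H' 0) = 1"
    using prob01 by (simp add: P.emeasure_eq_measure)
  with le le' show ?thesis
    unfolding H(3) by (rule_tac antisym) simp_all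
qed

subsection \<open>Functionals on bounded sequences\<close>

lemma apply_bcontfun_nat:
  fixes f :: "nat \<Rightarrow> real"
  assumes "\<And>i. \<bar>f i\<bar> \<le> B"
  shows "apply_bcontfun (Bcontfun f) = f"
  by (rule Bcontfun_inverse) (use assms in \<open>auto intro!: bcontfun_normI\<close>)

lemma apply_bcontfun_sum: "apply_bcontfun (\<Sum>j\<in>J. u j) i = (\<Sum>j\<in>J. apply_bcontfun (u j) i)"
  for u :: "'a \<Rightarrow> linfty"
  by (induction J rule: infinite_finite_induct) auto

definition linfty_unit :: "nat \<Rightarrow> linfty" where
  "linfty_unit i = Bcontfun (indicator {i})"

lemma apply_linfty_unit: "apply_bcontfun (linfty_unit i) = indicator {i}"
  unfolding linfty_unit_def by (rule apply_bcontfun_nat[of _ 1]) (simp add: indicator_def)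

lemma linfty_finite_support:
  fixes u :: linfty
  assumes "finite F" "\<And>i. i \<notin> F \<Longrightarrow> u i = 0"
  shows "u = (\<Sum>i\<in>F. u i *\<^sub>R linfty_unit i)"
proof (rule bcontfun_eqI)
  fix j
  have "(\<Sum>i\<in>F. u i * indicator {i} j) = (\<Sum>i\<in>F. if i = j then u i else 0)"
    by (intro sum.cong) (auto simp: indicator_def)
  then show "u j = apply_bcontfun (\<Sum>i\<in>F. u i *\<^sub>R linfty_unit i) j"
    using assms by (auto simp: apply_bcontfun_sum apply_linfty_unit)
qed

text \<open>Applied to the vector of signs of its own coefficients, which has norm at most 1,
  \<open>g\<close> returns the partial sum of their absolute values. The coefficients therefore form
  an absolutely summable sequence.\<close>

lemma summable_functional_unit:
  fixes g :: "linfty \<Rightarrow>\<^sub>L real"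
  shows "summable (\<lambda>i. \<bar>g (linfty_unit i)\<bar>)" "(\<Sum>i. \<bar>g (linfty_unit i)\<bar>) \<le> norm g"
proof -
  have "(\<Sum>i<N. \<bar>g (linfty_unit i)\<bar>) \<le> norm g" for N
  proof -
    let ?u = "\<Sum>i<N. sgn (g (linfty_unit i)) *\<^sub>R linfty_unit i"
    have "norm ?u \<le> 1"
    proof (rule norm_bound)
      fix j
      have "(\<Sum>i<N. sgn (g (linfty_unit i)) * indicator {i} j)
          = (\<Sum>i<N. if i = j then sgn (g (linfty_unit i)) else 0)"
        by (intro sum.cong) (auto simp: indicator_def)
      then show "norm (apply_bcontfun ?u j) \<le> 1"
        by (auto simp: apply_bcontfun_sum apply_linfty_unit abs_sgn_eq)
    qed
    moreover have "(\<Sum>i<N. \<bar>g (linfty_unit i)\<bar>) = g ?u"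
      by (simp add: blinfun.sum_right blinfun.scaleR_right abs_sgn mult.commute)
    ultimately show ?thesis
      using norm_blinfun[of g ?u] mult_left_mono[of "norm ?u" 1 "norm g"] by simp
  qed
  then show "summable (\<lambda>i. \<bar>g (linfty_unit i)\<bar>)" "(\<Sum>i. \<bar>g (linfty_unit i)\<bar>) \<le> norm g"
    by (auto intro!: summableI_nonneg_bounded suminf_le_const)
qed

lemma summable_functional_coord:
  fixes g :: "linfty \<Rightarrow>\<^sub>L real" and u :: linfty
  shows "summable (\<lambda>i. \<bar>g (linfty_unit i) * u i\<bar>)"
    "\<bar>\<Sum>i. g (linfty_unit i) * u i\<bar> \<le> norm g * norm u"
proof -
  have le: "\<bar>g (linfty_unit i) * u i\<bar> \<le> \<bar>g (linfty_unit i)\<bar> * norm u" for i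
    using norm_bounded[of u i] by (simp add: abs_mult mult_left_mono)
  have s: "summable (\<lambda>i. \<bar>g (linfty_unit i)\<bar> * norm u)"
    by (intro summable_mult2 summable_functional_unit)
  show sum: "summable (\<lambda>i. \<bar>g (linfty_unit i) * u i\<bar>)"
    by (rule summable_comparison_test'[OF s, of 0]) (use le in simp)
  have "\<bar>\<Sum>i. g (linfty_unit i) * u i\<bar> \<le> (\<Sum>i. \<bar>g (linfty_unit i) * u i\<bar>)"
    by (rule summable_rabs[OF sum])
  also have "\<dots> \<le> (\<Sum>i. \<bar>g (linfty_unit i)\<bar> * norm u)"
    by (rule suminf_le[OF le sum s])
  also have "\<dots> = (\<Sum>i. \<bar>g (linfty_unit i)\<bar>) * norm u"
    by (intro suminf_mult2[symmetric] summable_functional_unit)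
  also have "\<dots> \<le> norm g * norm u"
    by (intro mult_right_mono summable_functional_unit) simp
  finally show "\<bar>\<Sum>i. g (linfty_unit i) * u i\<bar> \<le> norm g * norm u" .
qed

text \<open>The dual of the bounded sequences splits into absolutely summable sequences and
  functionals vanishing on the null sequences; this is the second component of
  \<open>g\<close>.\<close>

definition singular_part :: "(linfty \<Rightarrow>\<^sub>L real) \<Rightarrow> linfty \<Rightarrow> real" where
  "singular_part g u = g u - (\<Sum>i. g (linfty_unit i) * u i)"

lemma linear_singular_part: "linear (singular_part g)"
proof (rule linearI)
  have s: "summable (\<lambda>i. g (linfty_unit i) * u i)" for u :: linfty
    using summable_functional_coord(1) by (rule summable_rabs_cancel)
  fix u v :: linfty and c :: real
  show "singular_part g (u + v) = singular_part g u + singular_part g v"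
    by (simp add: singular_part_def blinfun.add_right distrib_left suminf_add[OF s s, symmetric])
  show "singular_part g (c *\<^sub>R u) = c *\<^sub>R singular_part g u"
    using suminf_mult[OF s, of c u]
    by (simp add: singular_part_def blinfun.scaleR_right right_diff_distrib mult.left_commute)
qed

lemma abs_singular_part_le: "\<bar>singular_part g u\<bar> \<le> 2 * norm g * norm u"
  using summable_functional_coord(2)[of g u] norm_blinfun[of g u]
  by (simp add: singular_part_def)

lemma singular_part_minus: "singular_part (- g) u = - singular_part g u"
proof -
  have s: "summable (\<lambda>i. g (linfty_unit i) * u i)"
    using summable_functional_coord(1) by (rule summable_rabs_cancel)
  show ?thesis
    by (simp add: singular_part_def blinfun.minus_left suminf_minus[OF s])
qed

lemma singular_part_finite_support:
  assumes "finite F" "\<And>i. i \<notin> F \<Longrightarrow> apply_bcontfun u i = 0"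
  shows "singular_part g u = 0"
proof -
  have "g u = (\<Sum>i\<in>F. u i * g (linfty_unit i))"
    by (subst linfty_finite_support[OF assms]) (simp_all add: blinfun.sum_right blinfun.scaleR_right)
  moreover have "(\<Sum>i. g (linfty_unit i) * u i) = (\<Sum>i\<in>F. g (linfty_unit i) * u i)"
    using assms by (intro suminf_finite) auto
  ultimately show ?thesis by (simp add: singular_part_def mult.commute)
qed

text \<open>Cutting \<open>u\<close> off on \<open>F\<close> removes a finitely supported sequence,
  on which the singular part is zero, and leaves a sequence of norm at most
  \<open>b\<close>.\<close>

lemma singular_part_bound_cofinite:
  assumes F: "finite F" and b: "\<And>i. i \<notin> F \<Longrightarrow> \<bar>apply_bcontfun u i\<bar> \<le> b" and "0 \<le> b"
  shows "\<bar>singular_part g u\<bar> \<le> 2 * norm g * b"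
proof -
  define v :: linfty where "v = Bcontfun (\<lambda>i. if i \<in> F then u i else 0)"
  have v: "v i = (if i \<in> F then u i else 0)" for i
    unfolding v_def using norm_bounded[of u] by (subst apply_bcontfun_nat[of _ "norm u"]) auto
  have "norm (u - v) \<le> b"
    by (rule norm_bound) (use b \<open>0 \<le> b\<close> in \<open>simp add: v\<close>)
  then have "\<bar>singular_part g (u - v)\<bar> \<le> 2 * norm g * b"
    by (intro order_trans[OF abs_singular_part_le] mult_left_mono) auto
  also have "singular_part g (u - v) = singular_part g u - singular_part g v"
    by (rule linear_diff[OF linear_singular_part])
  also have "singular_part g v = 0"
    using F by (rule singular_part_finite_support) (simp add: v)
  finally show ?thesis by simp
qed

lemma singular_part_vanishing:
  assumes fin: "\<And>e. 0 < e \<Longrightarrow> finite {i. e \<le> \<bar>apply_bcontfun u i\<bar>}"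
  shows "singular_part g u = 0"
proof -
  have "\<bar>singular_part g u\<bar> \<le> 0 + e" if "0 < e" for e
  proof -
    \<comment> \<open>The summand 1 keeps the denominator positive when \<open>g\<close> is
      zero.\<close>
    define b where "b = e / (2 * norm g + 1)"
    have pos: "0 < 2 * norm g + 1" by (rule add_nonneg_pos) auto
    then have "0 < b" using that by (simp add: b_def)
    then have "\<bar>singular_part g u\<bar> \<le> 2 * norm g * b"
      using fin[of b] by (intro singular_part_bound_cofinite[of "{i. b \<le> \<bar>u i\<bar>}"]) auto
    also have "\<dots> \<le> (2 * norm g + 1) * b" using \<open>0 < b\<close> by (simp add: algebra_simps)
    also have "\<dots> = e" using pos by (simp add: b_def)
    finally show ?thesis by simp
  qed
  then have "\<bar>singular_part g u\<bar> \<le> 0" by (rule field_le_epsilon)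
  then show ?thesis by simp
qed

text \<open>
  The supports are almost disjoint, so the sum of the \<open>u j\<close> is bounded by \<open>1\<close> off a finite set,
  which a singular functional does not see.
\<close>

lemma singular_part_almost_disjoint:
  fixes u :: "nat \<Rightarrow> linfty"
  assumes u01: "\<And>j i. u j i \<in> {0, 1}"
    and disj: "\<And>i j. i < j \<Longrightarrow> j \<le> r \<Longrightarrow> finite {k. u i k \<noteq> 0 \<and> u j k \<noteq> 0}"
  shows "(\<Sum>j\<le>r. singular_part g (u j)) \<le> 2 * norm g"
proof -
  define F where "F = (\<Union>j\<in>{..r}. \<Union>i\<in>{..<j}. {k. u i k \<noteq> 0 \<and> u j k \<noteq> 0})"
  have F: "finite F" unfolding F_def using disj by auto
  have "\<bar>apply_bcontfun (\<Sum>j\<le>r. u j) k\<bar> \<le> 1" if k: "k \<notin> F" for k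
  proof (cases "\<exists>j\<le>r. u j k \<noteq> 0")
    case True
    then obtain j where j: "j \<le> r" "u j k \<noteq> 0" by blast
    have "u i k = 0" if "i \<le> r" "i \<noteq> j" for i
      using k j that by (cases i j rule: linorder_cases) (auto simp: F_def)
    then have "(\<Sum>i\<le>r. u i k) = (\<Sum>i\<in>{j}. u i k)"
      using j by (intro sum.mono_neutral_right) auto
    then show ?thesis using u01[of j k] by (auto simp: apply_bcontfun_sum)
  next
    case False
    then show ?thesis by (simp add: apply_bcontfun_sum)
  qed
  then have "\<bar>singular_part g (\<Sum>j\<le>r. u j)\<bar> \<le> 2 * norm g"
    using singular_part_bound_cofinite[OF F, of "\<Sum>j\<le>r. u j" 1 g] by simp
  then show ?thesis by (simp add: linear_sum[OF linear_singular_part])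
qed

subsection \<open>The test functions\<close>

text \<open>Completeness makes sets of outer measure zero measurable and lets measurability pass
  between functions equal almost everywhere.\<close>

lemma complete_measure_lebesgue_01: "complete_measure lebesgue_01"
  by unfold_locales (auto simp: null_sets_restrict_space sets_restrict_space_iff
      dest: completion.complete intro: subset_trans)

lemma (in complete_measure) null_sets_if_outer_measure_0:
  assumes "A \<subseteq> space M" "outer_measure_of M A = 0"
  shows "A \<in> null_sets M"
  by (metis assms complete2 null_setsI outer_measure_of_attain)

lemma (in complete_measure) borel_measurable_if_AE_eq:
  assumes f: "f \<in> borel_measurable M" and eq: "AE x in M. f x = g x"
  shows "g \<in> borel_measurable M"
proof (rule measurableI)
  fix A :: "'b set" assume A: "A \<in> sets borel"
  show "g -` A \<inter> space M \<in> sets M"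
  proof (rule in_sets_AE)
    show "f -` A \<inter> space M \<in> sets M" using f A by (rule measurable_sets)
    show "AE x in M. (x \<in> f -` A \<inter> space M) = (x \<in> g -` A \<inter> space M)"
      using eq by eventually_elim auto
  qed auto
qed simp

lemma emeasure_radix_digit:
  assumes n: "\<And>k. 0 < n k" and S: "S \<subseteq> {..<n m}"
  shows "emeasure lebesgue_01 {t\<in>{0..1}. radix_digit n m t \<in> S} = ennreal (card S / n m)"
proof -
  define B where "B j = (if j = m then S else {..<n j})" for j
  have "{t\<in>{0..1}. radix_digit n m t \<in> S} = {t\<in>{0..1}. \<forall>j<Suc m. radix_digit n j t \<in> B j}"
    using radix_digit_less[of n, OF n] by (auto simp: B_def less_Suc_eq)
  also have "emeasure lebesgue_01 \<dots> = (\<Prod>j<Suc m. ennreal (card (B j) / n j))"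
    using S by (intro emeasure_radix_digits_cylinder n) (auto simp: B_def)
  also have "\<dots> = (\<Prod>j\<in>{m}. ennreal (card (B j) / n j))"
    using n by (intro prod.mono_neutral_right) (auto simp: B_def)
  finally show ?thesis by (simp add: B_def)
qed

text \<open>The index \<open>i\<close> codes a pair of a stage \<open>m\<close> and a finite set \<open>S\<close> of possible values of \<open>x m\<close>.\<close>

definition stage :: "nat \<Rightarrow> nat" where
  "stage i = fst (prod_decode i)"

definition value_set :: "nat \<Rightarrow> nat set" where
  "value_set i = set_decode (snd (prod_decode i))"

lemma exists_index:
  assumes "finite S"
  obtains i where "stage i = m" "value_set i = S"
  using assms that[of "prod_encode (m, set_encode S)"] by (simp add: stage_def value_set_def)

locale chain_sequence =
  fixes n :: "nat \<Rightarrow> nat" and W :: "nat \<Rightarrow> (nat \<times> nat) set"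
  assumes n_ge: "2 ^ k \<le> n k"
    and W_subset: "W k \<subseteq> {..<n k} \<times> {..<n k}"
    and W_card: "real (card (W k)) \<le> (1 / 2) ^ k * (real (n k))\<^sup>2"
    and chains: "D \<subseteq> seq_space n \<Longrightarrow> outer_measure_of (seq_measure n) D = 1 \<Longrightarrow>
      \<exists>x :: nat \<Rightarrow> nat \<Rightarrow> nat. (\<forall>i\<le>r. x i \<in> D) \<and> (\<forall>i j. i < j \<and> j \<le> r \<longrightarrow> (x j, x i) \<in> seq_rel n W)"
begin

lemma n_pos: "0 < n k"
  using n_ge[of k] by (metis less_le_trans pos2 zero_less_power)

text \<open>The pairs \<open>(a, b)\<close> run over both orders, so distinct values are unrelated
  in either direction. The cardinality bound grows with the stage, leaving room for any finite
  sample eventually, yet is small compared with \<open>n (stage i)\<close>.\<close>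

definition admissible :: "nat \<Rightarrow> bool" where
  "admissible i \<longleftrightarrow> value_set i \<subseteq> {..<n (stage i)} \<and> card (value_set i) \<le> stage i \<and>
     (\<forall>a\<in>value_set i. \<forall>b\<in>value_set i. a \<noteq> b \<longrightarrow> (a, b) \<notin> W (stage i))"

text \<open>Inadmissible indices give the zero function, so that every natural number is a
  coordinate.\<close>

definition test :: "nat \<Rightarrow> real \<Rightarrow> real" where
  "test i t = (if admissible i \<and> radix_digit n (stage i) t \<in> value_set i then 1 else 0)"

definition test_seq :: "real \<Rightarrow> linfty" where
  "test_seq t = Bcontfun (\<lambda>i. test i t)"

lemma test_seq_apply: "apply_bcontfun (test_seq t) i = test i t"
  unfolding test_seq_def by (subst apply_bcontfun_nat[of _ 1]) (auto simp: test_def)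

lemma norm_test_seq: "norm (test_seq t) \<le> 1"
  by (rule norm_bound) (simp add: test_seq_apply test_def)

lemma measurable_test [measurable]: "test i \<in> borel_measurable lebesgue_01"
  unfolding test_def by measurable

text \<open>A stage \<open>k\<close> offers only the subsets of \<open>{..<n k}\<close>. Coordinates
  of bounded stage are thus invisible to singular parts.\<close>

lemma finite_admissible: "finite {i. admissible i \<and> stage i \<le> m}"
proof (rule finite_subset)
  show "{i. admissible i \<and> stage i \<le> m}
      \<subseteq> (\<Union>k\<in>{..m}. (\<lambda>S. prod_encode (k, set_encode S)) ` Pow {..<n k})"
  proof safe
    fix i assume i: "admissible i" "stage i \<le> m"
    have "i = prod_encode (stage i, set_encode (value_set i))"
      by (simp add: stage_def value_set_def)
    then show "i \<in> (\<Union>k\<in>{..m}. (\<lambda>S. prod_encode (k, set_encode S)) ` Pow {..<n k})"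
      using i unfolding admissible_def by blast
  qed
qed auto

text \<open>The chain hypothesis asks for full outer measure, while \<open>D\<close> is only
  non-null. Closing its digit sequences under finite modifications gives full outer measure; the
  price is that the relations hold only for all but finitely many digits.\<close>

lemma exists_chain:
  assumes D: "D \<subseteq> {0..1}" and pos: "0 < outer_measure_of lebesgue_01 D"
  obtains t :: "nat \<Rightarrow> real" where "\<And>j. j \<le> r \<Longrightarrow> t j \<in> D"
    "\<And>i j. i < j \<Longrightarrow> j \<le> r \<Longrightarrow> \<forall>\<^sub>F k in sequentially.
      (radix_digit n k (t j), radix_digit n k (t i)) \<in> W k \<and> radix_digit n k (t j) \<noteq> radix_digit n k (t i)"
proof -
  define D' where "D' = {x\<in>seq_space n. \<exists>t\<in>D. finite {k. x k \<noteq> radix_digit n k t}}"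
  have "radix_digits n ` D \<subseteq> D'"
  proof safe
    fix t assume "t \<in> D"
    then show "radix_digits n t \<in> D'"
      using radix_digit_less[of n, OF n_pos]
      by (auto simp: D'_def radix_digits_def seq_space_def intro!: bexI[of _ t])
  qed
  then have "0 < outer_measure_of (seq_measure n) D'"
    using pos outer_measure_of_radix_digits_image[OF n_pos D]
    by (meson less_le_trans outer_measure_of_mono)
  then have "outer_measure_of (seq_measure n) D' = 1"
  proof (rule outer_measure_of_finite_modification_closed[OF n_pos, rotated])
    show "D' \<subseteq> seq_space n" by (auto simp: D'_def)
    fix x y assume x: "x \<in> D'" and y: "y \<in> seq_space n" and fin: "finite {k. x k \<noteq> y k}"
    obtain t where t: "t \<in> D" "finite {k. x k \<noteq> radix_digit n k t}" using x by (auto simp: D'_def)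
    have "finite {k. y k \<noteq> radix_digit n k t}"
      by (rule finite_subset[OF _ finite_UnI[OF fin t(2)]]) auto
    then show "y \<in> D'" using y t(1) by (auto simp: D'_def)
  qed
  then obtain x where x: "\<forall>i\<le>r. x i \<in> D'" "\<forall>i j. i < j \<and> j \<le> r \<longrightarrow> (x j, x i) \<in> seq_rel n W"
    using chains[of D' r] by (auto simp: D'_def)
  from x(1) have "\<forall>i. \<exists>t. i \<le> r \<longrightarrow> t \<in> D \<and> finite {k. x i k \<noteq> radix_digit n k t}"
    by (auto simp: D'_def)
  then obtain t where t: "\<And>i. i \<le> r \<Longrightarrow> t i \<in> D \<and> finite {k. x i k \<noteq> radix_digit n k (t i)}"
    by metis
  have ev: "\<forall>\<^sub>F k in sequentially. x i k = radix_digit n k (t i)" if "i \<le> r" for i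
    using t[OF that] by (simp add: eventually_cofinite flip: cofinite_eq_sequentially)
  show thesis
  proof (rule that)
    fix i j assume ij: "i < j" "j \<le> r"
    then have R: "(x j, x i) \<in> seq_rel n W" using x(2) by blast
    then have "\<forall>\<^sub>F k in sequentially. x j k \<noteq> x i k"
      by (simp add: seq_rel_def eventually_cofinite flip: cofinite_eq_sequentially)
    moreover have "\<forall>\<^sub>F k in sequentially. x i k = radix_digit n k (t i)"
      "\<forall>\<^sub>F k in sequentially. x j k = radix_digit n k (t j)"
      using ev[of i] ev[of j] ij by simp_all
    ultimately show "\<forall>\<^sub>F k in sequentially.
      (radix_digit n k (t j), radix_digit n k (t i)) \<in> W k \<and> radix_digit n k (t j) \<noteq> radix_digit n k (t i)"
    proof (eventually_elim, goal_cases)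
      case (1 k)
      have "(x j k, x i k) \<in> W k" using R by (simp add: seq_rel_def)
      then show ?case using 1 by simp
    qed
  qed (use t in blast)
qed

text \<open>Measurability of the singular part is not yet available, hence the outer measure. A
  chain of \<open>r + 1\<close> points in the set makes the sum of singular parts at least
  \<open>(r + 1) * e\<close>, against the bound \<open>2 * norm g\<close> for almost disjoint
  supports.\<close>

lemma outer_measure_singular_part:
  assumes "0 < e"
  shows "outer_measure_of lebesgue_01 {t\<in>{0..1}. e \<le> singular_part g (test_seq t)} = 0"
proof (rule ccontr)
  let ?D = "{t\<in>{0..1}. e \<le> singular_part g (test_seq t)}"
  assume "outer_measure_of lebesgue_01 ?D \<noteq> 0"
  then have pos: "0 < outer_measure_of lebesgue_01 ?D" by (simp add: zero_less_iff_neq_zero)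
  obtain r :: nat where r: "2 * norm g / e < real r" using reals_Archimedean2 by blast
  obtain t :: "nat \<Rightarrow> real" where t: "\<And>j. j \<le> r \<Longrightarrow> t j \<in> ?D"
    "\<And>i j. i < j \<Longrightarrow> j \<le> r \<Longrightarrow> \<forall>\<^sub>F k in sequentially.
      (radix_digit n k (t j), radix_digit n k (t i)) \<in> W k \<and> radix_digit n k (t j) \<noteq> radix_digit n k (t i)"
    by (rule exists_chain[OF _ pos, of r]; blast)
  have "(\<Sum>j\<le>r. singular_part g (test_seq (t j))) \<le> 2 * norm g"
  proof (rule singular_part_almost_disjoint)
    fix i j assume ij: "i < j" "j \<le> r"
    then obtain K where K: "\<And>k. k \<ge> K \<Longrightarrow> (radix_digit n k (t j), radix_digit n k (t i)) \<in> W k"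
      "\<And>k. k \<ge> K \<Longrightarrow> radix_digit n k (t j) \<noteq> radix_digit n k (t i)"
      using t(2)[of i j] unfolding eventually_sequentially by blast
    \<comment> \<open>A common test of stage beyond \<open>K\<close> would have two distinct values
      related by \<open>W\<close> in its value set, contrary to admissibility.\<close>
    have "{k. test k (t i) \<noteq> 0 \<and> test k (t j) \<noteq> 0} \<subseteq> {k. admissible k \<and> stage k \<le> K}"
    proof (safe)
      fix k assume k: "test k (t i) \<noteq> 0" "test k (t j) \<noteq> 0"
      then show "admissible k" by (auto simp: test_def split: if_splits)
      show "stage k \<le> K"
      proof (rule ccontr)
        assume "\<not> stage k \<le> K"
        then show False using k K[of "stage k"] by (auto simp: test_def admissible_def split: if_splits)
      qed
    qed
    then show "finite {k. test_seq (t i) k \<noteq> 0 \<and> test_seq (t j) k \<noteq> 0}"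
      by (simp add: test_seq_apply finite_subset[OF _ finite_admissible])
  qed (simp add: test_seq_apply test_def)
  moreover have "real (Suc r) * e \<le> (\<Sum>j\<le>r. singular_part g (test_seq (t j)))"
    using sum_bounded_below[of "{..r}" e "\<lambda>j. singular_part g (test_seq (t j))"] t(1) by simp
  moreover have "2 * norm g < real r * e" using r assms by (simp add: field_simps)
  ultimately show False using assms by (simp add: algebra_simps)
qed

lemma AE_singular_part: "AE t in lebesgue_01. singular_part g (test_seq t) = 0"
proof -
  interpret complete_measure lebesgue_01 by (rule complete_measure_lebesgue_01)
  have *: "AE t in lebesgue_01. \<not> e \<le> singular_part h (test_seq t)" if "0 < e" for e h
  proof (rule AE_I')
    show "{t\<in>{0..1}. e \<le> singular_part h (test_seq t)} \<in> null_sets lebesgue_01"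
      by (rule null_sets_if_outer_measure_0[OF _ outer_measure_singular_part[OF that]]) auto
  qed auto
  \<comment> \<open>Countably many thresholds exclude positive values; using \<open>- g\<close> as
    well excludes negative ones.\<close>
  have "AE t in lebesgue_01. \<forall>k. \<not> 1 / real (Suc k) \<le> singular_part g (test_seq t)"
    "AE t in lebesgue_01. \<forall>k. \<not> 1 / real (Suc k) \<le> singular_part (- g) (test_seq t)"
    unfolding AE_all_countable using * by simp_all
  then show ?thesis
  proof eventually_elim
    case (elim t)
    then have "\<not> 0 < singular_part g (test_seq t)" "\<not> 0 < - singular_part g (test_seq t)"
      unfolding singular_part_minus
      by (metis less_imp_le nat_approx_posE)+
    then show ?case by simp
  qed
qed

lemma functional_test_seq_AE:
  "AE t in lebesgue_01. (\<Sum>i. blinfun_apply g (linfty_unit i) * test i t) = blinfun_apply g (test_seq t)"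
  using AE_singular_part[of g] by eventually_elim (simp add: singular_part_def test_seq_apply)

lemma measurable_functional_test_seq [measurable]:
  fixes g :: "linfty \<Rightarrow>\<^sub>L real"
  shows "(\<lambda>t. blinfun_apply g (test_seq t)) \<in> borel_measurable lebesgue_01"
proof -
  interpret complete_measure lebesgue_01 by (rule complete_measure_lebesgue_01)
  have "(\<lambda>t. \<Sum>i. blinfun_apply g (linfty_unit i) * test i t) \<in> borel_measurable lebesgue_01"
    by measurable
  then show ?thesis
    using functional_test_seq_AE by (rule borel_measurable_if_AE_eq)
qed

lemma bounded_functional_test_seq:
  fixes g :: "linfty \<Rightarrow>\<^sub>L real"
  shows "\<bar>blinfun_apply g (test_seq t)\<bar> \<le> norm g"
  using norm_blinfun[of g "test_seq t"] mult_left_mono[OF norm_test_seq[of t] norm_ge_zero[of g]] by simp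

section \<open>Pettis integrability of the test sequence\<close>

lemma integrable_test: "integrable lebesgue_01 (test i)"
proof -
  interpret prob_space lebesgue_01 by (rule prob_space_lebesgue_01)
  show ?thesis by (rule integrable_const_bound[of _ 1]) (auto simp: test_def)
qed

lemma integral_test_le: "integral\<^sup>L lebesgue_01 (test i) \<le> (if admissible i then real (stage i) / 2 ^ stage i else 0)"
proof (cases "admissible i")
  case True
  let ?A = "{t\<in>{0..1}. radix_digit n (stage i) t \<in> value_set i}"
  have "integral\<^sup>L lebesgue_01 (test i) = integral\<^sup>L lebesgue_01 (indicator ?A)"
    by (rule Bochner_Integration.integral_cong) (auto simp: test_def True)
  also have "\<dots> = measure lebesgue_01 ?A"
  proof -
    have "{t\<in>space lebesgue_01. radix_digit n (stage i) t \<in> value_set i} \<in> sets lebesgue_01" by measurable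
    then show ?thesis by (subst Bochner_Integration.integral_indicator) (auto intro!: arg_cong[where f="measure lebesgue_01"])
  qed
  also have "\<dots> = card (value_set i) / n (stage i)"
    using True emeasure_radix_digit[of n "value_set i" "stage i", OF n_pos]
    by (simp add: measure_def admissible_def)
  also have "\<dots> \<le> real (stage i) / 2 ^ stage i"
    using True n_ge[of "stage i"] by (intro frac_le) (auto simp: admissible_def simp flip: of_nat_power_le_of_nat_cancel_iff)
  finally show ?thesis using True by simp
qed (simp add: test_def[abs_def])

lemma bounded_set_integral_test:
  assumes E: "E \<in> sets lebesgue_01"
  shows "\<bar>set_lebesgue_integral lebesgue_01 E (test i)\<bar> \<le> integral\<^sup>L lebesgue_01 (test i)"
proof -
  have "set_lebesgue_integral lebesgue_01 E (test i) \<ge> 0"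
    unfolding set_lebesgue_integral_def
    by (intro Bochner_Integration.integral_nonneg) (auto simp: test_def indicator_def)
  moreover have "set_lebesgue_integral lebesgue_01 E (test i) \<le> integral\<^sup>L lebesgue_01 (test i)"
    unfolding set_lebesgue_integral_def
    by (intro integral_mono integrable_mult_indicator E integrable_test) (auto simp: test_def indicator_def)
  ultimately show ?thesis by simp
qed

text \<open>A large integral forces an admissible index of small stage, since
  \<open>m / 2 ^ m\<close> tends to 0, and there are finitely many of those.\<close>

lemma finite_integral_test_ge:
  assumes "0 < e"
  shows "finite {i. e \<le> integral\<^sup>L lebesgue_01 (test i)}"
proof -
  have lim: "(\<lambda>m. real m / 2 ^ m) \<longlonglongrightarrow> 0" by real_asymp
  then obtain M where M: "\<And>m. m \<ge> M \<Longrightarrow> real m / 2 ^ m < e"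
    using order_tendstoD(2)[OF lim assms] unfolding eventually_sequentially by blast
  have "{i. e \<le> integral\<^sup>L lebesgue_01 (test i)} \<subseteq> {i. admissible i \<and> stage i \<le> M}"
  proof safe
    fix i assume e: "e \<le> integral\<^sup>L lebesgue_01 (test i)"
    then show "admissible i"
      using integral_test_le[of i] assms by (auto split: if_splits)
    then show "stage i \<le> M"
      using integral_test_le[of i] M[of "stage i"] e by (auto intro: ccontr)
  qed
  then show ?thesis by (rule finite_subset[OF _ finite_admissible])
qed

text \<open>The candidate integral over \<open>E\<close> is the sequence of integrals of the tests.
  Almost everywhere \<open>g\<close> acts through its coefficient series, which is integrated term
  by term; the result equals \<open>g\<close> at the candidate because the candidate is a null
  sequence.\<close>

lemma Pettis_integrable_test_seq: "Pettis_integrable_01 test_seq"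
  unfolding Pettis_integrable_01_def scalarly_measurable_01_def
proof (intro conjI allI exI[of _ "\<lambda>E. Bcontfun (\<lambda>i. set_lebesgue_integral lebesgue_01 E (test i))"] ballI)
  interpret prob_space lebesgue_01 by (rule prob_space_lebesgue_01)
  fix g :: "linfty \<Rightarrow>\<^sub>L real"
  show "(\<lambda>t. g (test_seq t)) \<in> borel_measurable lebesgue_01" by measurable
  fix E assume E [measurable]: "E \<in> sets lebesgue_01"
  let ?I = "\<lambda>i. set_lebesgue_integral lebesgue_01 E (test i)"
  have int1: "integral\<^sup>L lebesgue_01 (test i) \<le> 1" for i
    by (rule integral_le_const[OF integrable_test]) (simp add: test_def)
  have apply_I: "apply_bcontfun (Bcontfun ?I) = ?I"
    by (rule apply_bcontfun_nat[of _ 1]) (use bounded_set_integral_test[OF E] int1 in \<open>meson order_trans\<close>)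
  have "integrable lebesgue_01 (\<lambda>t. g (test_seq t))"
    by (rule integrable_const_bound[of _ "norm g"]) (use bounded_functional_test_seq in auto)
  then show "set_integrable lebesgue_01 E (\<lambda>t. g (test_seq t))"
    unfolding set_integrable_def by (rule integrable_mult_indicator[OF E])
  have s: "summable (\<lambda>i. \<bar>g (linfty_unit i)\<bar>)" by (rule summable_functional_unit)
  have "set_lebesgue_integral lebesgue_01 E (\<lambda>t. g (test_seq t))
      = (\<integral>t. (\<Sum>i. g (linfty_unit i) * (indicator E t * test i t)) \<partial>lebesgue_01)"
    unfolding set_lebesgue_integral_def
  proof (rule integral_cong_AE)
    show "AE t in lebesgue_01. indicator E t *\<^sub>R g (test_seq t)
        = (\<Sum>i. g (linfty_unit i) * (indicator E t * test i t))"
      using functional_test_seq_AE[of g] by eventually_elim (auto simp: indicator_def)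
  qed measurable
  also have "\<dots> = (\<Sum>i. \<integral>t. g (linfty_unit i) * (indicator E t * test i t) \<partial>lebesgue_01)"
  proof (rule integral_suminf)
    have i: "integrable lebesgue_01 (\<lambda>t. indicator E t * test i t)" for i
      using integrable_mult_indicator[OF E integrable_test[of i]] by simp
    then show "integrable lebesgue_01 (\<lambda>t. g (linfty_unit i) * (indicator E t * test i t))" for i
      by simp
    \<comment> \<open>Tests take values 0 and 1, so the summable coefficients dominate the series
      uniformly in \<open>t\<close>.\<close>
    have le: "norm (g (linfty_unit i) * (indicator E t * test i t)) \<le> \<bar>g (linfty_unit i)\<bar>" for i t
      by (auto simp: test_def indicator_def)
    show "AE t in lebesgue_01. summable (\<lambda>i. norm (g (linfty_unit i) * (indicator E t * test i t)))"
      by (intro AE_I2 summable_comparison_test'[OF s, of 0]) (use le in simp)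
    have "(\<integral>t. norm (g (linfty_unit i) * (indicator E t * test i t)) \<partial>lebesgue_01) \<le> \<bar>g (linfty_unit i)\<bar>" for i
      by (rule integral_le_const) (use le i in auto)
    then show "summable (\<lambda>i. \<integral>t. norm (g (linfty_unit i) * (indicator E t * test i t)) \<partial>lebesgue_01)"
      by (intro summable_comparison_test'[OF s, of 0]) simp
  qed
  also have "\<dots> = (\<Sum>i. g (linfty_unit i) * apply_bcontfun (Bcontfun ?I) i)"
    by (subst apply_I) (simp add: set_lebesgue_integral_def)
  also have "\<dots> = g (Bcontfun ?I)"
  proof -
    have "singular_part g (Bcontfun ?I) = 0"
    proof (rule singular_part_vanishing, unfold apply_I)
      fix e :: real assume "0 < e"
      then have "finite {i. e \<le> integral\<^sup>L lebesgue_01 (test i)}"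
        by (rule finite_integral_test_ge)
      then show "finite {i. e \<le> \<bar>?I i\<bar>}"
        by (rule finite_subset[rotated]) (use bounded_set_integral_test[OF E] in \<open>auto intro: order_trans\<close>)
    qed
    then show ?thesis by (simp add: singular_part_def)
  qed
  finally show "set_lebesgue_integral lebesgue_01 E (\<lambda>t. g (test_seq t)) = g (Bcontfun ?I)" .
qed

end

subsection \<open>Failure of stability\<close>

text \<open>Applies to sets not known to be measurable: a measurable hull contains almost every
  point.\<close>

lemma outer_measure_of_eq_1_if_AE:
  assumes "prob_space P" "A \<subseteq> space P" "AE z in P. z \<in> A"
  shows "outer_measure_of P A = 1"
proof -
  interpret prob_space P by fact
  obtain H where H: "H \<in> sets P" "A \<subseteq> H" "outer_measure_of P A = emeasure P H"
    using outer_measure_of_attain[OF assms(2)] by blast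
  have "AE z in P. z \<in> H" using assms(3) by eventually_elim (use H(2) in blast)
  then show ?thesis using H emeasure_eq_1_AE by simp
qed

text \<open>Supplies the independence of two coordinates, whether both come from one factor or one
  from each; \<open>J\<close> and \<open>K\<close> select them.\<close>

lemma emeasure_pair_PiM_Collect:
  fixes M :: "'a measure" and I J K L :: "'i set"
  assumes M: "prob_space M" and J: "J \<subseteq> I" "finite J" "\<And>h. h \<in> J \<Longrightarrow> A h \<in> sets M"
    and K: "K \<subseteq> L" "finite K" "\<And>h. h \<in> K \<Longrightarrow> B h \<in> sets M"
  defines "P \<equiv> PiM I (\<lambda>_. M) \<Otimes>\<^sub>M PiM L (\<lambda>_. M)"
  shows "emeasure P {z\<in>space P. (\<forall>h\<in>J. fst z h \<in> A h) \<and> (\<forall>h\<in>K. snd z h \<in> B h)}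
    = (\<Prod>h\<in>J. emeasure M (A h)) * (\<Prod>h\<in>K. emeasure M (B h))"
proof -
  let ?X = "PiM I (\<lambda>_. M)" and ?Y = "PiM L (\<lambda>_. M)"
  interpret M: prob_space M by (rule M)
  have PP: "product_prob_space (\<lambda>_. M)" by unfold_locales
  have Y: "prob_space ?Y" by (intro prob_space_PiM M)
  have Collect_sets: "{x\<in>space (PiM I' (\<lambda>_. M)). \<forall>h\<in>J'. x h \<in> A' h} \<in> sets (PiM I' (\<lambda>_. M))"
    if "J' \<subseteq> I'" "finite J'" "\<And>h. h \<in> J' \<Longrightarrow> A' h \<in> sets M" for I' J' and A' :: "'i \<Rightarrow> 'a set"
  proof (rule sets.sets_Collect_finite_All)
    fix h assume "h \<in> J'"
    then show "{x\<in>space (PiM I' (\<lambda>_. M)). x h \<in> A' h} \<in> sets (PiM I' (\<lambda>_. M))"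
      using that by (intro sets_Collect_single) auto
  qed (use that in auto)
  have "{z\<in>space P. (\<forall>h\<in>J. fst z h \<in> A h) \<and> (\<forall>h\<in>K. snd z h \<in> B h)}
    = {x\<in>space ?X. \<forall>h\<in>J. x h \<in> A h} \<times> {y\<in>space ?Y. \<forall>h\<in>K. y h \<in> B h}"
    by (auto simp: P_def space_pair_measure)
  also have "emeasure P \<dots> = emeasure ?X {x\<in>space ?X. \<forall>h\<in>J. x h \<in> A h} * emeasure ?Y {y\<in>space ?Y. \<forall>h\<in>K. y h \<in> B h}"
    unfolding P_def
    by (intro sigma_finite_measure.emeasure_pair_measure_Times[OF prob_space_imp_sigma_finite[OF Y]]
        Collect_sets J K)
  also have "\<dots> = (\<Prod>h\<in>J. emeasure M (A h)) * (\<Prod>h\<in>K. emeasure M (B h))"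
    by (intro arg_cong2[where f = "(*)"] product_prob_space.emeasure_PiM_Collect PP J K)
  finally show ?thesis .
qed

context chain_sequence
begin

lemma emeasure_radix_digit_singleton:
  assumes "a < n m"
  shows "emeasure lebesgue_01 (radix_digit n m -` {a} \<inter> {0..1}) = ennreal (1 / n m)"
proof -
  have "radix_digit n m -` {a} \<inter> {0..1} = {t\<in>{0..1}. radix_digit n m t \<in> {a}}" by auto
  then show ?thesis using emeasure_radix_digit[of n "{a}" m, OF n_pos] assms by simp
qed

text \<open>The measure of the \<open>m\<close>-th bad event is at most \<open>2\<^sup>-\<^sup>m\<close>, so Borel-Cantelli applies.\<close>

lemma AE_eventually_radix_digits_notin:
  assumes P: "prob_space P"
    and U: "U \<in> P \<rightarrow>\<^sub>M lebesgue_01" and V: "V \<in> P \<rightarrow>\<^sub>M lebesgue_01"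
    and indep: "\<And>A B. A \<in> sets lebesgue_01 \<Longrightarrow> B \<in> sets lebesgue_01 \<Longrightarrow>
      emeasure P {z\<in>space P. U z \<in> A \<and> V z \<in> B} = emeasure lebesgue_01 A * emeasure lebesgue_01 B"
    and Q: "\<And>m. Q m \<subseteq> {..<n m} \<times> {..<n m}"
    and card_Q: "\<And>m. real (card (Q m)) \<le> (1 / 2) ^ m * (real (n m))\<^sup>2"
  shows "AE z in P. \<forall>\<^sub>F m in sequentially. (radix_digit n m (U z), radix_digit n m (V z)) \<notin> Q m"
proof -
  interpret prob_space P by fact
  define A where "A m = (\<Union>(a, b)\<in>Q m. {z\<in>space P. U z \<in> radix_digit n m -` {a} \<inter> {0..1} \<and>
    V z \<in> radix_digit n m -` {b} \<inter> {0..1}})" for m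
  have fin: "finite (Q m)" for m
    using Q by (rule finite_subset) auto
  have D: "radix_digit n m -` {a} \<inter> {0..1} \<in> sets lebesgue_01" for m a
    using measurable_sets[OF measurable_radix_digit[of n m], of "{a}"] by simp
  have UV: "{z\<in>space P. U z \<in> radix_digit n m -` {a} \<inter> {0..1} \<and> V z \<in> radix_digit n m -` {b} \<inter> {0..1}} \<in> sets P"
    for m a b
  proof -
    have "{z\<in>space P. U z \<in> radix_digit n m -` {a} \<inter> {0..1} \<and> V z \<in> radix_digit n m -` {b} \<inter> {0..1}}
      = (U -` (radix_digit n m -` {a} \<inter> {0..1}) \<inter> space P) \<inter> (V -` (radix_digit n m -` {b} \<inter> {0..1}) \<inter> space P)"
      by blast
    then show ?thesis
      using measurable_sets[OF U D] measurable_sets[OF V D] by (metis sets.Int)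
  qed
  have A_sets: "A m \<in> sets P" for m
    unfolding A_def using UV fin by (intro sets.finite_UN) auto
  have "emeasure P (A m) \<le> ennreal ((1 / 2) ^ m)" for m
  proof -
    have "emeasure P (A m) \<le> (\<Sum>(a, b)\<in>Q m. emeasure P {z\<in>space P.
        U z \<in> radix_digit n m -` {a} \<inter> {0..1} \<and> V z \<in> radix_digit n m -` {b} \<inter> {0..1}})"
      unfolding A_def case_prod_beta by (rule emeasure_subadditive_finite[OF fin]) (use UV in auto)
    \<comment> \<open>By independence each pair of digits has probability \<open>1 / n m\<close>
      squared.\<close>
    also have "\<dots> = (\<Sum>ab\<in>Q m. ennreal (1 / n m) * ennreal (1 / n m))"
      using Q[of m] unfolding case_prod_beta
      by (intro sum.cong refl) (auto simp only: indep[OF D D] emeasure_radix_digit_singleton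
        subset_eq lessThan_iff mem_Times_iff)
    also have "\<dots> = ennreal (card (Q m) / (real (n m))\<^sup>2)"
      by (simp add: ennreal_of_nat_eq_real_of_nat power2_eq_square flip: ennreal_mult')
    also have "\<dots> \<le> ennreal ((1 / 2) ^ m)"
      using card_Q[of m] n_pos[of m] by (intro ennreal_leI) (simp add: divide_simps)
    finally show ?thesis .
  qed
  then have "measure P (A m) \<le> (1 / 2) ^ m" for m
    by (simp add: emeasure_eq_measure)
  then have "summable (\<lambda>m. measure P (A m))"
    by (intro summable_comparison_test'[OF summable_geometric[of "1 / 2 :: real"], of 0]) auto
  then have "AE z in P. \<forall>\<^sub>F m in sequentially. z \<in> space P - A m"
    by (intro borel_cantelli_AE1 A_sets) (auto simp: emeasure_eq_measure)
  then show ?thesis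
    using AE_space
  proof eventually_elim
    case (elim z)
    have "U z \<in> {0..1}" "V z \<in> {0..1}"
      using measurable_space[OF U elim(2)] measurable_space[OF V elim(2)] by simp_all
    show ?case
      using elim(1)
      by eventually_elim (use elim(2) \<open>U z \<in> {0..1}\<close> \<open>V z \<in> {0..1}\<close> in \<open>fastforce simp: A_def\<close>)
  qed
qed

text \<open>Stability fails for the levels 0 and 1 on the whole interval. For any \<open>k\<close>
  and \<open>l\<close>, at a late stage almost every sample has the digits of \<open>x\<close>
  disjoint from those of \<open>y\<close>, and those of \<open>y\<close> mutually unrelated; the
  test on the digits of \<open>y\<close> then separates the sample.\<close>

lemma not_stable_if_tests:
  assumes tests: "\<And>i. (\<lambda>t\<in>{0..1}. test i t) \<in> A"
  shows "\<not> stable_01 A"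
proof
  assume "stable_01 A"
  moreover have one: "emeasure lebesgue_01 {0..1} = 1"
    using prob_space.emeasure_space_1[OF prob_space_lebesgue_01] by simp
  moreover have "{0..1} \<in> sets lebesgue_01"
    using sets.top[of lebesgue_01] by simp
  ultimately obtain k l :: nat where less: "outer_measure_of
      ((\<Pi>\<^sub>M i\<in>{..<k}. lebesgue_01) \<Otimes>\<^sub>M (\<Pi>\<^sub>M j\<in>{..<l}. lebesgue_01))
      {(x, y). x \<in> (\<Pi>\<^sub>E i\<in>{..<k}. {0..1}) \<and> y \<in> (\<Pi>\<^sub>E j\<in>{..<l}. {0..1}) \<and>
        (\<exists>f\<in>A. \<forall>i<k. \<forall>j<l. f (x i) \<le> 0 \<and> f (y j) \<ge> 1)} < 1"
    unfolding stable_01_def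
    by (elim allE[of _ "0::real"] allE[of _ "1::real"] allE[of _ "{0..1::real}"]) auto
  let ?X = "\<Pi>\<^sub>M i\<in>{..<k}. lebesgue_01" and ?Y = "\<Pi>\<^sub>M i\<in>{..<l}. lebesgue_01"
  let ?P = "?X \<Otimes>\<^sub>M ?Y"
  let ?S = "{(x, y). x \<in> (\<Pi>\<^sub>E i\<in>{..<k}. {0..1}) \<and> y \<in> (\<Pi>\<^sub>E j\<in>{..<l}. {0..1}) \<and>
        (\<exists>f\<in>A. \<forall>i<k. \<forall>j<l. f (x i) \<le> 0 \<and> f (y j) \<ge> (1::real))}"
  interpret L: prob_space lebesgue_01 by (rule prob_space_lebesgue_01)
  have X: "prob_space ?X" and Y: "prob_space ?Y"
    by (intro prob_space_PiM L.prob_space_axioms)+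
  then have P: "prob_space ?P" by (rule prob_space_pair)
  have ev_xy: "AE z in ?P. \<forall>\<^sub>F m in sequentially. radix_digit n m (fst z i) \<noteq> radix_digit n m (snd z j)"
    if ij: "i < k" "j < l" for i j
  proof -
    \<comment> \<open>Coincidence of digits is the diagonal relation, whose \<open>n m\<close>
      elements meet the cardinality bound because \<open>n m\<close> is at least
      \<open>2 ^ m\<close>.\<close>
    have "AE z in ?P. \<forall>\<^sub>F m in sequentially.
      (radix_digit n m (fst z i), radix_digit n m (snd z j)) \<notin> (\<lambda>a. (a, a)) ` {..<n m}"
    proof (rule AE_eventually_radix_digits_notin)
      show "prob_space ?P" by (rule P)
      show "(\<lambda>z. fst z i) \<in> ?P \<rightarrow>\<^sub>M lebesgue_01" "(\<lambda>z. snd z j) \<in> ?P \<rightarrow>\<^sub>M lebesgue_01"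
        using ij by (auto intro!: measurable_compose[OF measurable_fst measurable_component_singleton]
          measurable_compose[OF measurable_snd measurable_component_singleton])
      fix B C assume BC: "B \<in> sets lebesgue_01" "C \<in> sets lebesgue_01"
      show "emeasure ?P {z\<in>space ?P. fst z i \<in> B \<and> snd z j \<in> C}
        = emeasure lebesgue_01 B * emeasure lebesgue_01 C"
        using emeasure_pair_PiM_Collect[OF prob_space_lebesgue_01, of "{i}" "{..<k}" "\<lambda>_. B" "{j}" "{..<l}" "\<lambda>_. C"]
          ij BC by (simp only: ball_simps prod.insert_if) simp
    next
      fix m
      have "2 ^ m \<le> real (n m)" using n_ge[of m] by (metis of_nat_le_iff of_nat_numeral of_nat_power)
      then have "(1 / 2) ^ m * (2 ^ m * real (n m)) \<le> (1 / 2) ^ m * (real (n m) * real (n m))"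
        by (intro mult_left_mono mult_right_mono) simp_all
      also have "(1 / 2) ^ m * (2 ^ m * real (n m)) = card ((\<lambda>a. (a, a)) ` {..<n m})"
        by (simp add: card_image inj_on_def power_one_over)
      finally show "real (card ((\<lambda>a. (a, a)) ` {..<n m})) \<le> (1 / 2) ^ m * (real (n m))\<^sup>2"
        by (simp only: power2_eq_square)
    qed auto
    then show ?thesis
      by eventually_elim (erule eventually_mono, use radix_digit_less[of n, OF n_pos] in auto)
  qed
  have ev_yy: "AE z in ?P. \<forall>\<^sub>F m in sequentially. (radix_digit n m (snd z i), radix_digit n m (snd z j)) \<notin> W m"
    if ij: "i < l" "j < l" "i \<noteq> j" for i j
  proof (rule AE_eventually_radix_digits_notin)
    show "prob_space ?P" by (rule P)
    show "(\<lambda>z. snd z i) \<in> ?P \<rightarrow>\<^sub>M lebesgue_01" "(\<lambda>z. snd z j) \<in> ?P \<rightarrow>\<^sub>M lebesgue_01"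
      using ij by (auto intro!: measurable_compose[OF measurable_snd measurable_component_singleton])
    fix B C assume BC: "B \<in> sets lebesgue_01" "C \<in> sets lebesgue_01"
    \<comment> \<open>Well chosen as \<open>i\<close> and \<open>j\<close> differ: coordinate
      \<open>i\<close> is constrained by \<open>B\<close> and coordinate \<open>j\<close> by
      \<open>C\<close>.\<close>
    let ?Z = "\<lambda>h. if h = i then B else C"
    show "emeasure ?P {z\<in>space ?P. snd z i \<in> B \<and> snd z j \<in> C}
        = emeasure lebesgue_01 B * emeasure lebesgue_01 C"
      using emeasure_pair_PiM_Collect[OF prob_space_lebesgue_01, of "{}" "{..<k}" "\<lambda>_. B" "{i, j}" "{..<l}" ?Z]
        ij BC by (simp only: ball_simps prod.insert_if) simp
  qed (use W_subset W_card in auto)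
  have "AE z in ?P. \<forall>i\<in>{..<k}. \<forall>j\<in>{..<l}. \<forall>\<^sub>F m in sequentially.
      radix_digit n m (fst z i) \<noteq> radix_digit n m (snd z j)"
    using ev_xy by (intro AE_finite_allI) auto
  moreover have "AE z in ?P. \<forall>i\<in>{..<l}. \<forall>j\<in>{..<l} - {i}. \<forall>\<^sub>F m in sequentially.
      (radix_digit n m (snd z i), radix_digit n m (snd z j)) \<notin> W m"
    using ev_yy by (intro AE_finite_allI) auto
  ultimately have "AE z in ?P. z \<in> ?S"
    using AE_space
  proof eventually_elim
    case (elim z)
    obtain x y where z: "z = (x, y)" by fastforce
    have x: "x \<in> (\<Pi>\<^sub>E i\<in>{..<k}. {0..1})" and y: "y \<in> (\<Pi>\<^sub>E j\<in>{..<l}. {0..1})"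
      using elim(3) by (auto simp: z space_pair_measure space_PiM)
    have "\<forall>\<^sub>F m in sequentially. l \<le> m \<and>
      (\<forall>i\<in>{..<k}. \<forall>j\<in>{..<l}. radix_digit n m (x i) \<noteq> radix_digit n m (y j)) \<and>
      (\<forall>i\<in>{..<l}. \<forall>j\<in>{..<l} - {i}. (radix_digit n m (y i), radix_digit n m (y j)) \<notin> W m)"
      using elim(1,2) unfolding z
      by (simp add: eventually_conj_iff eventually_ge_at_top eventually_ball_finite_distrib)
    then obtain m where m: "l \<le> m"
      "\<And>i j. i < k \<Longrightarrow> j < l \<Longrightarrow> radix_digit n m (x i) \<noteq> radix_digit n m (y j)"
      "\<And>i j. i < l \<Longrightarrow> j < l \<Longrightarrow> i \<noteq> j \<Longrightarrow> (radix_digit n m (y i), radix_digit n m (y j)) \<notin> W m"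
      using eventually_happens'[OF sequentially_bot] by fastforce
    \<comment> \<open>At most \<open>l\<close> values, hence at most \<open>m\<close> by the choice
      of the stage, as admissibility demands.\<close>
    define S where "S = (\<lambda>j. radix_digit n m (y j)) ` {..<l}"
    obtain i where i: "stage i = m" "value_set i = S"
      by (rule exists_index[of S m]) (auto simp: S_def)
    have "card S \<le> m" using card_image_le[of "{..<l}"] m(1) unfolding S_def by (metis card_lessThan finite_lessThan order_trans)
    moreover have "(a, b) \<notin> W m" if "a \<in> S" "b \<in> S" "a \<noteq> b" for a b
      using that m(3) by (auto simp: S_def)
    ultimately have adm: "admissible i"
      using radix_digit_less[of n, OF n_pos] by (auto simp: admissible_def i S_def)
    have "\<forall>a<k. \<forall>b<l. (\<lambda>t\<in>{0..1}. test i t) (x a) \<le> 0 \<and> (\<lambda>t\<in>{0..1}. test i t) (y b) \<ge> 1"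
    proof (intro allI impI conjI)
      fix a b assume a: "a < k" and b: "b < l"
      show "(\<lambda>t\<in>{0..1}. test i t) (x a) \<le> 0"
        using PiE_mem[OF x, of a] a m(2) by (auto simp: test_def i S_def)
      show "(\<lambda>t\<in>{0..1}. test i t) (y b) \<ge> 1"
        using PiE_mem[OF y, of b] b adm by (auto simp: test_def i S_def)
    qed
    then show ?case using x y tests[of i] unfolding z by blast
  qed
  moreover have "?S \<subseteq> space ?P"
    by (auto simp: space_pair_measure space_PiM)
  ultimately have "outer_measure_of ?P ?S = 1"
    by (intro outer_measure_of_eq_1_if_AE) (rule P)
  with less show False by simp
qed

end

subsection \<open>Compactness and convexity\<close>

lemma abs_linfty_apply_le: "\<bar>apply_bcontfun u i\<bar> \<le> norm u" for u :: linfty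
  using norm_bounded[of u i] by simp

definition linfty_eval :: "nat \<Rightarrow> linfty \<Rightarrow>\<^sub>L real" where
  "linfty_eval i = Blinfun (\<lambda>u. apply_bcontfun u i)"

lemma linfty_eval_apply: "linfty_eval i u = apply_bcontfun u i"
  unfolding linfty_eval_def
  by (subst bounded_linear_Blinfun_apply)
    (auto intro!: bounded_linear_intro[of _ 1] simp: abs_linfty_apply_le)

lemma norm_linfty_eval: "norm (linfty_eval i) \<le> 1"
  by (rule norm_blinfun_bound) (simp_all add: linfty_eval_apply abs_linfty_apply_le)

text \<open>Banach-Alaoglu, without a topology on the dual.\<close>

lemma compact_dual_ball:
  "compact {G :: 'a::real_normed_vector \<Rightarrow> real. linear G \<and> (\<forall>u. \<bar>G u\<bar> \<le> norm u)}"
proof -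
  let ?C = "PiE UNIV (\<lambda>u::'a. {- norm u..norm u})"
  have "compact ?C"
    using compactin_PiE[of "\<lambda>_::'a. euclideanreal" UNIV "\<lambda>u. {- norm u..norm u}"]
    by (simp add: euclidean_product_topology)
  \<comment> \<open>Linearity is a family of equations between finitely many coordinates of
    \<open>G\<close>, hence a closed condition in the pointwise topology.\<close>
  moreover have "closed {G :: 'a \<Rightarrow> real. (\<forall>u v. G (u + v) = G u + G v) \<and> (\<forall>c u. G (c *\<^sub>R u) = c * G u)}"
    by (intro closed_Collect_conj closed_Collect_all closed_Collect_eq continuous_intros)
      (auto intro: continuous_on_product_coordinates)
  ultimately have "compact (?C \<inter> {G. (\<forall>u v. G (u + v) = G u + G v) \<and> (\<forall>c u. G (c *\<^sub>R u) = c * G u)})"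
    by (rule compact_Int_closed)
  also have "?C \<inter> {G. (\<forall>u v. G (u + v) = G u + G v) \<and> (\<forall>c u. G (c *\<^sub>R u) = c * G u)}
      = {G. linear G \<and> (\<forall>u. \<bar>G u\<bar> \<le> norm u)}"
    by (auto simp: linear_iff abs_le_iff PiE_iff minus_le_iff)
  finally show ?thesis .
qed

text \<open>Composition with \<open>\<phi>\<close> is continuous for pointwise convergence, so the
  image of the compact dual ball is compact.\<close>

lemma compactin_functional_images:
  fixes \<phi> :: "real \<Rightarrow> 'a::real_normed_vector"
  shows "compactin (powertop_real I) {(\<lambda>t\<in>I. blinfun_apply g (\<phi> t)) | g. norm g \<le> (1::real)}"
proof -
  let ?L = "{G :: 'a \<Rightarrow> real. linear G \<and> (\<forall>u. \<bar>G u\<bar> \<le> norm u)}"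
  have "continuous_map euclidean (powertop_real I) (\<lambda>G. \<lambda>t\<in>I. G (\<phi> t))"
    by (auto simp: continuous_map_componentwise continuous_map_iff_continuous2
        intro: continuous_on_product_coordinates)
  then have "compactin (powertop_real I) ((\<lambda>G. \<lambda>t\<in>I. G (\<phi> t)) ` ?L)"
    by (rule image_compactin[rotated]) (simp add: compact_dual_ball)
  also have "(\<lambda>G. \<lambda>t\<in>I. G (\<phi> t)) ` ?L = {(\<lambda>t\<in>I. blinfun_apply g (\<phi> t)) | g. norm g \<le> 1}"
  proof safe
    fix G :: "'a \<Rightarrow> real" assume G: "linear G" "\<forall>u. \<bar>G u\<bar> \<le> norm u"
    then have bl: "bounded_linear G"
      by (intro bounded_linear_intro[of _ 1]) (auto simp: linear_add linear_cmul)
    then have "norm (Blinfun G) \<le> 1"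
      using G by (intro norm_blinfun_bound) (auto simp: bounded_linear_Blinfun_apply)
    then show "\<exists>g. (\<lambda>t\<in>I. G (\<phi> t)) = (\<lambda>t\<in>I. blinfun_apply g (\<phi> t)) \<and> norm g \<le> 1"
      using bl by (intro exI[of _ "Blinfun G"]) (simp add: bounded_linear_Blinfun_apply)
  next
    fix g :: "'a \<Rightarrow>\<^sub>L real" assume g: "norm g \<le> 1"
    have "\<bar>g u\<bar> \<le> norm u" for u
      using norm_blinfun[of g u] mult_right_mono[OF g norm_ge_zero[of u]] by simp
    then show "(\<lambda>t\<in>I. blinfun_apply g (\<phi> t)) \<in> (\<lambda>G. \<lambda>t\<in>I. G (\<phi> t)) ` ?L"
      by (intro image_eqI[of _ _ "blinfun_apply g"])
        (auto simp: linear_iff blinfun.add_right blinfun.scaleR_right)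
  qed
  finally show ?thesis .
qed

text \<open>Averages over lists with repetition: a countable set closed under rational convex combinations.\<close>

definition averages :: "(nat \<Rightarrow> real \<Rightarrow> real) \<Rightarrow> (real \<Rightarrow> real) set" where
  "averages f = {(\<lambda>t\<in>{0..1}. (\<Sum>i\<leftarrow>xs. f i t) / length xs) | xs. xs \<noteq> []}"

lemma countable_averages: "countable (averages f)"
proof -
  have "averages f \<subseteq> range (\<lambda>xs. \<lambda>t\<in>{0..1}. (\<Sum>i\<leftarrow>xs. f i t) / length xs)"
    by (auto simp: averages_def)
  then show ?thesis by (rule countable_subset) simp
qed

lemma averages_rational_convex:
  assumes "g \<in> averages f" "h \<in> averages f" "u \<in> \<rat>" "0 \<le> u" "u \<le> 1"
  shows "(\<lambda>t\<in>{0..1}. (1 - u) * g t + u * h t) \<in> averages f"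
proof -
  obtain xs ys where xs: "xs \<noteq> []" "g = (\<lambda>t\<in>{0..1}. (\<Sum>i\<leftarrow>xs. f i t) / length xs)"
    and ys: "ys \<noteq> []" "h = (\<lambda>t\<in>{0..1}. (\<Sum>i\<leftarrow>ys. f i t) / length ys)"
    using assms by (auto simp: averages_def)
  obtain p q :: nat where pq: "q \<noteq> 0" "u = real p / real q"
    using Rats_abs_nat_div_natE[OF assms(3)] assms(4) by (metis abs_of_nonneg)
  have "p \<le> q" using assms(5) pq by (simp add: divide_simps split: if_splits)
  have rep: "(\<Sum>i\<leftarrow>concat (replicate m zs). f i t) = real m * (\<Sum>i\<leftarrow>zs. f i t)" for m zs t
    by (induction m) (auto simp: algebra_simps)
  have len: "length (concat (replicate m zs)) = m * length zs" for m and zs :: "nat list"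
    by (induction m) auto
  \<comment> \<open>With \<open>u = p / q\<close>, these repetition counts cancel the different
    lengths of \<open>xs\<close> and \<open>ys\<close> and weight the two averages by
    \<open>1 - u\<close> and \<open>u\<close>.\<close>
  define zs where "zs = concat (replicate ((q - p) * length ys) xs) @ concat (replicate (p * length xs) ys)"
  have len_zs: "length zs = q * length xs * length ys"
  proof -
    have "length zs = (q - p + p) * length xs * length ys"
      by (simp only: zs_def length_append len algebra_simps)
    then show ?thesis using \<open>p \<le> q\<close> by simp
  qed
  have "(1 - u) * ((\<Sum>i\<leftarrow>xs. f i t) / length xs) + u * ((\<Sum>i\<leftarrow>ys. f i t) / length ys)
      = (\<Sum>i\<leftarrow>zs. f i t) / length zs" for t
  proof -
    have "(\<Sum>i\<leftarrow>zs. f i t) = (real q - real p) * length ys * (\<Sum>i\<leftarrow>xs. f i t)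
        + real p * length xs * (\<Sum>i\<leftarrow>ys. f i t)"
      using \<open>p \<le> q\<close> by (simp add: zs_def rep)
    then show ?thesis
      using xs(1) ys(1) pq(1) by (simp add: len_zs pq(2) field_simps)
  qed
  moreover have "zs \<noteq> []" using len_zs xs(1) ys(1) pq(1) by auto
  ultimately show ?thesis
    by (auto simp: averages_def xs(2) ys(2) cong: restrict_cong intro!: exI[of _ zs])
qed

text \<open>The convex combination depends jointly continuously on the coefficient and the two
  functions, and rational coefficients are dense in the unit interval; so closure under rational
  combinations passes to real ones.\<close>

lemma convex_closure_of_averages:
  "convex_01 (powertop_real {0..1} closure_of averages f)"
  unfolding convex_01_def
proof (intro ballI)
  let ?T = "powertop_real {0..1::real}"
  fix g h :: "real \<Rightarrow> real" and u :: real
  assume g: "g \<in> ?T closure_of averages f" and h: "h \<in> ?T closure_of averages f" and u: "u \<in> {0..1}"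
  let ?F = "\<lambda>(u, g, h). \<lambda>t\<in>{0..1::real}. (1 - u) * g t + u * (h t :: real)"
  let ?S = "prod_topology euclideanreal (prod_topology ?T ?T)"
  have cont: "continuous_map ?S ?T ?F"
    unfolding continuous_map_componentwise
  proof (intro conjI ballI)
    fix t :: real assume t: "t \<in> {0..1}"
    have "continuous_map ?S euclideanreal (\<lambda>p. (1 - fst p) * fst (snd p) t + fst p * snd (snd p) t)"
    proof (intro continuous_intros)
      show "continuous_map ?S euclideanreal (\<lambda>p. fst (snd p) t)"
        using continuous_map_compose[OF continuous_map_compose[OF continuous_map_snd continuous_map_fst]
          continuous_map_product_projection[OF t]] by (simp add: comp_def)
      show "continuous_map ?S euclideanreal (\<lambda>p. snd (snd p) t)"
        using continuous_map_compose[OF continuous_map_compose[OF continuous_map_snd continuous_map_snd]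
          continuous_map_product_projection[OF t]] by (simp add: comp_def)
    qed (auto intro: continuous_map_fst)
    then show "continuous_map ?S euclideanreal (\<lambda>p. ?F p t)"
      using t by (simp add: case_prod_beta)
  qed auto
  have "(u, g, h) \<in> ?S closure_of ((\<rat> \<inter> {0..1}) \<times> averages f \<times> averages f)"
  proof -
    have "closure ({0<..<1::real} \<inter> \<rat>) = {0..1}"
      by (subst closure_open_Int_superset) (auto simp: Rats_closure_real)
    then have "u \<in> closure (\<rat> \<inter> {0..1})"
      using u closure_mono[of "{0<..<1} \<inter> \<rat>" "\<rat> \<inter> {0..1}"] by force
    then show ?thesis using g h u by (simp add: closure_of_Times)
  qed
  then have "?F (u, g, h) \<in> ?T closure_of (?F ` ((\<rat> \<inter> {0..1}) \<times> averages f \<times> averages f))"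
    using continuous_map_image_closure_subset[OF cont] by blast
  moreover have "?F ` ((\<rat> \<inter> {0..1}) \<times> averages f \<times> averages f) \<subseteq> averages f"
    using averages_rational_convex by auto
  ultimately show "(\<lambda>t\<in>{0..1}. (1 - u) * g t + u * h t) \<in> ?T closure_of averages f"
    using closure_of_mono by fastforce
qed

context chain_sequence
begin

section \<open>The closed hull of the tests and the two examples\<close>

abbreviation functional_images :: "(real \<Rightarrow> real) set" where
  "functional_images \<equiv> {(\<lambda>t\<in>{0..1}. blinfun_apply g (test_seq t)) | g. norm g \<le> 1}"

text \<open>An average of tests comes from the corresponding average of coordinate functionals,
  which has norm at most 1.\<close>

lemma averages_subset: "averages test \<subseteq> functional_images"
proof
  fix h assume "h \<in> averages test"
  then obtain xs where xs: "xs \<noteq> []" "h = (\<lambda>t\<in>{0..1}. (\<Sum>i\<leftarrow>xs. test i t) / length xs)"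
    by (auto simp: averages_def)
  define g where "g = (1 / length xs) *\<^sub>R (\<Sum>i\<leftarrow>xs. linfty_eval i)"
  have "norm (\<Sum>i\<leftarrow>xs. linfty_eval i) \<le> length xs"
  proof (induction xs)
    case (Cons i xs)
    then show ?case
      using norm_triangle_ineq[of "linfty_eval i" "\<Sum>i\<leftarrow>xs. linfty_eval i"] norm_linfty_eval[of i] by simp
  qed simp
  then have "norm g \<le> 1" using xs(1) by (simp add: g_def)
  moreover have "blinfun_apply (\<Sum>i\<leftarrow>xs. linfty_eval i) (test_seq t) = (\<Sum>i\<leftarrow>xs. test i t)" for t
    by (induction xs) (auto simp: blinfun.add_left blinfun.zero_left linfty_eval_apply test_seq_apply)
  then have "blinfun_apply g (test_seq t) = (\<Sum>i\<leftarrow>xs. test i t) / length xs" for t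
    by (simp add: g_def blinfun.scaleR_left)
  ultimately show "h \<in> functional_images"
    unfolding xs(2) by (intro CollectI exI[of _ g]) simp
qed

lemma test_in_averages: "(\<lambda>t\<in>{0..1}. test i t) \<in> averages test"
  unfolding averages_def by (intro CollectI exI[of _ "[i]"]) simp

lemma functional_images_subset_L0: "functional_images \<subseteq> L0_01"
proof safe
  fix g :: "linfty \<Rightarrow>\<^sub>L real"
  have "(\<lambda>t\<in>{0..1}. blinfun_apply g (test_seq t)) \<in> borel_measurable lebesgue_01
      \<longleftrightarrow> (\<lambda>t. blinfun_apply g (test_seq t)) \<in> borel_measurable lebesgue_01"
    by (rule measurable_cong) simp
  then show "(\<lambda>t\<in>{0..1}. blinfun_apply g (test_seq t)) \<in> L0_01"
    using measurable_functional_test_seq[of g] by (simp add: L0_01_def)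
qed

lemma bounded_Pettis_not_stable:
  "\<exists>\<phi> :: real \<Rightarrow> linfty. bounded (\<phi> ` {0..1}) \<and> Pettis_integrable_01 \<phi> \<and>
     \<not> stable_01 {(\<lambda>t\<in>{0..1}. blinfun_apply g (\<phi> t)) | g. norm g \<le> 1}"
proof (intro exI[of _ test_seq] conjI)
  show "bounded (test_seq ` {0..1})"
    using norm_test_seq by (auto intro: boundedI)
  show "Pettis_integrable_01 test_seq" by (rule Pettis_integrable_test_seq)
  show "\<not> stable_01 functional_images"
    using test_in_averages averages_subset by (intro not_stable_if_tests) blast
qed

text \<open>The closure of the averages has a countable dense subset by construction. It lies in the
  compact, hence closed, set \<open>functional_images\<close>, which gives compactness and
  measurability of its members, and it contains all the tests.\<close>

lemma separable_compact_not_stable: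
  "\<exists>K. K \<subseteq> L0_01 \<and> convex_01 K \<and> separable_space (subtopology (powertop_real {0..1}) K) \<and>
     compactin (powertop_real {0..1}) K \<and> \<not> stable_01 K"
proof (intro exI conjI)
  let ?T = "powertop_real {0..1::real}" let ?A = "averages test" let ?K = "?T closure_of ?A"
  have cpt: "compactin ?T functional_images" by (rule compactin_functional_images)
  have "Hausdorff_space ?T" by (simp add: Hausdorff_space_product_topology)
  then have "closedin ?T functional_images" using cpt by (rule compactin_imp_closedin)
  then have sub: "?K \<subseteq> functional_images" by (rule closure_of_minimal[OF averages_subset])
  show "?K \<subseteq> L0_01" using sub functional_images_subset_L0 by blast
  show "convex_01 ?K" by (rule convex_closure_of_averages)
  show "compactin ?T ?K" using cpt sub by (rule closed_compactin) simp
  have A_top: "?A \<subseteq> topspace ?T" by (auto simp: averages_def)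
  then have A_K: "?A \<subseteq> ?K" by (rule closure_of_subset)
  then show "\<not> stable_01 ?K" using test_in_averages by (intro not_stable_if_tests) blast
  have "subtopology ?T ?K closure_of ?A = topspace (subtopology ?T ?K)"
    by (simp add: closure_of_subtopology Int_absorb1 A_K topspace_subtopology_subset closure_of_subset_topspace
        del: topspace_product_topology)
  then show "separable_space (subtopology ?T ?K)"
    unfolding separable_space_def
    using countable_averages A_top A_K by (intro exI[of _ ?A]) auto
qed

end

theorem mainTheorem9:
  assumes "dagger"
  shows "(\<exists>\<phi> :: real \<Rightarrow> linfty.
            bounded (\<phi> ` {0..1}) \<and> Pettis_integrable_01 \<phi> \<and>
            \<not> stable_01 {(\<lambda>t\<in>{0..1}. blinfun_apply g (\<phi> t)) | g. norm g \<le> 1})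
       \<and> (\<exists>K. K \<subseteq> L0_01 \<and> convex_01 K \<and>
            separable_space (subtopology (powertop_real {0..1}) K) \<and>
            compactin (powertop_real {0..1}) K \<and>
            \<not> stable_01 K)"
proof -
  obtain n W where "chain_sequence n W"
    using assms unfolding dagger_def chain_sequence_def by metis
  then show ?thesis
    using chain_sequence.bounded_Pettis_not_stable chain_sequence.separable_compact_not_stable by blast
qed

end
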